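(* For every $c\in(0,1]$, \[ \Pr(\hat L_n\le c\ln n)=n^{-K(c)+o(1)}\qquad(n\to\infty), \] where $K(c)=\frac{(1-c)^2}{8c}$.
   Context: $(B_t)_{t\ge0}$ is a standard Brownian motion and $\hat L_n=\int_1^nB_t^2/t^2\,dt$. *)

theory Defs
  imports "HOL-Probability.Probability"
begin

definition standard_brownian_motion :: "'a measure \<Rightarrow> (real \<Rightarrow> 'a \<Rightarrow> real) \<Rightarrow> bool" where
  "standard_brownian_motion M B \<longleftrightarrow>
     prob_space M \<and>
     (\<forall>t\<ge>0. B t \<in> borel_measurable M) \<and>
     (\<forall>\<omega>\<in>space M. B 0 \<omega> = 0) \<and>
     (\<forall>\<omega>\<in>space M. continuous_on {0..} (\<lambda>t. B t \<omega>)) \<and>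
     (\<forall>s t. 0 \<le> s \<and> s < t \<longrightarrow>
        distributed M lborel (\<lambda>\<omega>. B t \<omega> - B s \<omega>) (\<lambda>x. ennreal (normal_density 0 (sqrt (t - s)) x))) \<and>
     (\<forall>ts::real list. sorted_wrt (<) ts \<and> (\<forall>t\<in>set ts. 0 \<le> t) \<longrightarrow>
        prob_space.indep_vars M (\<lambda>_. borel)
          (\<lambda>i \<omega>. B (ts ! Suc i) \<omega> - B (ts ! i) \<omega>) {..<length ts - 1})"

definition Lhat :: "(real \<Rightarrow> 'a \<Rightarrow> real) \<Rightarrow> real \<Rightarrow> 'a \<Rightarrow> real" where
  "Lhat B n \<omega> = integral {1..n} (\<lambda>t. (B t \<omega>)^2 / t^2)"

definition K :: "real \<Rightarrow> real" where
  "K c = (1 - c)^2 / (8 * c)"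

end

theory Submission
  imports Defs
begin

text \<open>
  On the geometric grid \<open>\<rho>\<^sup>k\<close> the Laplace transform of the Riemann sums of \<open>\<integral> B\<^sub>t\<^sup>2 / t\<^sup>2 dt\<close> is
  computed by integrating out the Gaussian increments one at a time, from the last to the first; the
  coefficient of the remaining quadratic exponent then follows a Riccati iteration whose fixed point
  tends, as the mesh goes to 0, to the solution \<open>s \<ge> 0\<close> of \<open>s + 2 s\<^sup>2 = l\<close>. Hence
  \<open>E exp (- l L) = n\<^bsup>- s + o(1)\<^esup>\<close>, where \<open>L\<close> is the integral over \<open>[1, n]\<close>.
  Since the limiting exponent is smooth in \<open>l\<close>, its Legendre transform \<open>s - (s + 2 s\<^sup>2) c\<close> at
  \<open>s = (1/c - 1)/4\<close>, which is \<open>K c\<close>, governs the lower tail: the upper bound is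
  Chernoff's inequality, and the lower bound is obtained by exponential tilting.
\<close>

section \<open>Deterministic and Gaussian preliminaries\<close>

text \<open>Uniform continuity of \<open>g\<close> on the compact interval bounds the error on each
  cell by \<open>e'\<close> times its length, as soon as the mesh of the geometric partition is
  below \<open>d\<close>.\<close>

lemma geometric_riemann_sum_tendsto:
  fixes g :: "real \<Rightarrow> real"
  assumes g: "continuous_on {1..n} g" and n: "1 \<le> n"
  shows "(\<lambda>N. \<Sum>k<N. g (exp (ln n / N) ^ Suc k) * (exp (ln n / N) ^ Suc k - exp (ln n / N) ^ k))
           \<longlonglongrightarrow> integral {1..n} g"
proof (rule LIMSEQ_I)
  fix e :: real assume e: "e > 0"
  \<comment> \<open>The cell errors will add up to \<open>e' * (n - 1)\<close>, which this choice
    keeps below \<open>e\<close>.\<close>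
  define e' where "e' = e / (2 * n)"
  have e': "e' > 0" using e n by (simp add: e'_def)
  have "uniformly_continuous_on {1..n} g"
    using g by (simp add: compact_uniformly_continuous)
  then obtain d where d: "d > 0"
    "\<And>x y. x \<in> {1..n} \<Longrightarrow> y \<in> {1..n} \<Longrightarrow> dist y x < d \<Longrightarrow> dist (g y) (g x) < e'"
    using e' unfolding uniformly_continuous_on_def by (meson e')
  \<comment> \<open>With \<rho> = \<open>exp (ln n / N)\<close> every cell has length at most
    \<open>n * (\<rho> - 1)\<close>, so this limit says that the mesh tends to 0.\<close>
  have "(\<lambda>N. n * (exp (ln n / real N) - 1)) \<longlonglongrightarrow> n * (exp 0 - 1)"
    by (intro tendsto_intros lim_const_over_n)
  then have "(\<lambda>N. n * (exp (ln n / real N) - 1)) \<longlonglongrightarrow> 0" by simp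
  then obtain N0 where N0: "\<And>N. N \<ge> N0 \<Longrightarrow> \<bar>n * (exp (ln n / real N) - 1)\<bar> < d"
    using LIMSEQ_D[OF _ d(1), of "\<lambda>N. n * (exp (ln n / real N) - 1)" 0] by auto
  show "\<exists>no. \<forall>N\<ge>no. norm ((\<Sum>k<N. g (exp (ln n / N) ^ Suc k) * (exp (ln n / N) ^ Suc k - exp (ln n / N) ^ k))
           - integral {1..n} g) < e"
  proof (intro exI allI impI)
    \<comment> \<open>The bound \<open>N \<ge> 1\<close> excludes division by zero, which would give
      \<rho> = 1 and spoil \<open>\<rho> ^ N = n\<close>.\<close>
    fix N assume N: "N \<ge> max 1 N0"
    define \<rho> where "\<rho> = exp (ln n / N)"
    have \<rho>1: "\<rho> \<ge> 1" using n by (simp add: \<rho>_def)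
    have \<rho>N: "\<rho> ^ N = n" using N n by (simp add: \<rho>_def exp_of_nat_mult [symmetric])
    have ge1: "\<rho> ^ k \<ge> 1" for k using \<rho>1 by simp
    have mono: "\<rho> ^ k \<le> \<rho> ^ Suc k" for k using \<rho>1 by simp
    have le: "\<rho> ^ k \<le> n" if "k \<le> N" for k
      using power_increasing[OF that \<rho>1] \<rho>N by simp
    have gint: "g integrable_on {a..b}" if "1 \<le> a" "b \<le> n" for a b
      using g that by (intro integrable_continuous_real) (auto elim: continuous_on_subset)
    have combine: "integral {1..\<rho> ^ m} g = (\<Sum>k<m. integral {\<rho> ^ k..\<rho> ^ Suc k} g)" if "m \<le> N" for m
      using that
    proof (induction m)
      case (Suc m)
      have "integral {1..\<rho> ^ m} g + integral {\<rho> ^ m..\<rho> ^ Suc m} g = integral {1..\<rho> ^ Suc m} g"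
        using ge1 mono le[OF Suc.prems] by (intro Henstock_Kurzweil_Integration.integral_combine gint) auto
      with Suc show ?case by simp
    qed simp
    have cell: "\<bar>g (\<rho> ^ Suc k) * (\<rho> ^ Suc k - \<rho> ^ k) - integral {\<rho> ^ k..\<rho> ^ Suc k} g\<bar>
        \<le> e' * (\<rho> ^ Suc k - \<rho> ^ k)" if k: "k < N" for k
    proof -
      have kn: "\<rho> ^ Suc k \<le> n" using le[of "Suc k"] k by simp
      have len: "\<rho> ^ Suc k - \<rho> ^ k < d"
      proof -
        have "\<rho> ^ Suc k - \<rho> ^ k = \<rho> ^ k * (\<rho> - 1)" by (simp add: algebra_simps)
        also have "\<dots> \<le> n * (\<rho> - 1)" using le[of k] k \<rho>1 by (intro mult_right_mono) auto
        also have "\<dots> < d" using N0[of N] N by (simp add: \<rho>_def)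
        finally show ?thesis .
      qed
      have "((\<lambda>x. g (\<rho> ^ Suc k) - g x) has_integral
          (g (\<rho> ^ Suc k) * (\<rho> ^ Suc k - \<rho> ^ k) - integral {\<rho> ^ k..\<rho> ^ Suc k} g)) {\<rho> ^ k..\<rho> ^ Suc k}"
        using has_integral_const_real[of "g (\<rho> ^ Suc k)" "\<rho> ^ k" "\<rho> ^ Suc k"] mono[of k]
        by (intro has_integral_diff integrable_integral gint ge1 kn) (simp add: mult.commute)
      then have "norm (g (\<rho> ^ Suc k) * (\<rho> ^ Suc k - \<rho> ^ k) - integral {\<rho> ^ k..\<rho> ^ Suc k} g)
          \<le> e' * measure lborel {\<rho> ^ k..\<rho> ^ Suc k}"
      proof (rule has_integral_bound_real[rotated 2])
        fix x assume x: "x \<in> {\<rho> ^ k..\<rho> ^ Suc k} - {}"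
        have "dist (g (\<rho> ^ Suc k)) (g x) < e'"
          using x ge1[of k] ge1[of "Suc k"] kn len by (intro d(2)) (auto simp: dist_real_def)
        then show "norm (g (\<rho> ^ Suc k) - g x) \<le> e'" by (simp add: dist_real_def)
      qed (use e' in auto)
      then show ?thesis using mono[of k] by simp
    qed
    have "\<bar>(\<Sum>k<N. g (\<rho> ^ Suc k) * (\<rho> ^ Suc k - \<rho> ^ k)) - integral {1..n} g\<bar>
        = \<bar>\<Sum>k<N. g (\<rho> ^ Suc k) * (\<rho> ^ Suc k - \<rho> ^ k) - integral {\<rho> ^ k..\<rho> ^ Suc k} g\<bar>"
      using combine[of N] \<rho>N by (simp add: sum_subtractf)
    also have "\<dots> \<le> (\<Sum>k<N. e' * (\<rho> ^ Suc k - \<rho> ^ k))"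
      by (rule order.trans[OF sum_abs sum_mono]) (use cell in auto)
    also have "\<dots> = e' * (n - 1)"
      using sum_lessThan_telescope[of "\<lambda>k. \<rho> ^ k" N] \<rho>N by (simp add: sum_distrib_left[symmetric])
    also have "\<dots> < e" using e n by (simp add: e'_def field_simps add_pos_pos)
    finally show "norm ((\<Sum>k<N. g (exp (ln n / N) ^ Suc k) * (exp (ln n / N) ^ Suc k - exp (ln n / N) ^ k))
           - integral {1..n} g) < e" by (simp add: \<rho>_def)
  qed
qed

text \<open>Completing the square in \<open>y\<close>: the product is again a Gaussian density in
  \<open>y\<close>, with variance \<open>v / w\<close> for \<open>w = 1 + 2 * a * v\<close>, times a
  factor that does not depend on \<open>y\<close>.\<close>

lemma normal_density_times_gaussian:
  assumes v: "v > 0" and a: "a \<ge> 0"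
  shows "normal_density 0 (sqrt v) y * exp (- (a * (x + y)\<^sup>2))
    = exp (- (a * x\<^sup>2 / (1 + 2 * a * v))) / sqrt (1 + 2 * a * v)
      * normal_density (- (2 * a * v * x / (1 + 2 * a * v))) (sqrt (v / (1 + 2 * a * v))) y"
proof -
  define w where "w = 1 + 2 * a * v"
  have w: "w > 0" using v a by (simp add: w_def add_pos_nonneg)
  have "- y\<^sup>2 / (2 * v) - a * (x + y)\<^sup>2
      = - (a * x\<^sup>2 / w) - (y + 2 * a * v * x / w)\<^sup>2 / (2 * (v / w))"
  proof -
    have "(- y\<^sup>2 / (2 * v) - a * (x + y)\<^sup>2) * (2 * v * w)
      = (- (a * x\<^sup>2 / w) - (y + 2 * a * v * x / w)\<^sup>2 / (2 * (v / w))) * (2 * v * w)"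
    proof -
      have "(- y\<^sup>2 / (2 * v) - a * (x + y)\<^sup>2) * (2 * v * w) = - (y\<^sup>2 * w) - 2 * a * v * w * (x + y)\<^sup>2"
        using v by (simp add: field_simps)
      also have "\<dots> = - (2 * v * a * x\<^sup>2) - (w * y + 2 * a * v * x)\<^sup>2"
        by (simp add: w_def power2_eq_square algebra_simps)
      also have "\<dots> = (- (a * x\<^sup>2 / w) - (y + 2 * a * v * x / w)\<^sup>2 / (2 * (v / w))) * (2 * v * w)"
      proof -
        have "w * y + 2 * a * v * x = w * (y + 2 * a * v * x / w)" using w by (simp add: field_simps)
        then have "(w * y + 2 * a * v * x)\<^sup>2 = w\<^sup>2 * (y + 2 * a * v * x / w)\<^sup>2" by (simp add: power_mult_distrib)
        then show ?thesis using v w by (simp add: field_simps power2_eq_square)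
      qed
      finally show ?thesis .
    qed
    then show ?thesis using v w by simp
  qed
  then have "exp (- y\<^sup>2 / (2 * v)) * exp (- (a * (x + y)\<^sup>2))
      = exp (- (a * x\<^sup>2 / w)) * exp (- ((y + 2 * a * v * x / w)\<^sup>2 / (2 * (v / w))))"
    by (simp add: exp_add [symmetric])
  \<comment> \<open>Changing the variance from \<open>v\<close> to \<open>v / w\<close> in the
    normalising constant is the source of the factor \<open>1 / sqrt w\<close>.\<close>
  moreover have "1 / sqrt (2 * pi * v) = 1 / sqrt w * (1 / sqrt (2 * pi * (v / w)))"
    using v w by (simp add: real_sqrt_mult real_sqrt_divide field_simps)
  ultimately have "1 / sqrt (2 * pi * v) * (exp (- y\<^sup>2 / (2 * v)) * exp (- (a * (x + y)\<^sup>2)))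
      = 1 / sqrt w * (1 / sqrt (2 * pi * (v / w))) *
      (exp (- (a * x\<^sup>2 / w)) * exp (- ((y + 2 * a * v * x / w)\<^sup>2 / (2 * (v / w)))))"
    by (simp only:)
  then show ?thesis
    using v w unfolding w_def[symmetric] normal_density_def by (simp add: mult_ac)
qed

text \<open>The shifted density obtained by completing the square has total mass 1. Averaging over a
  Gaussian increment thus keeps the quadratic exponential form, which is why the recursion on the
  grid closes.\<close>

lemma nn_integral_normal_gaussian:
  assumes v: "v > 0" and a: "a \<ge> 0"
  shows "(\<integral>\<^sup>+ y. ennreal (normal_density 0 (sqrt v) y) * ennreal (exp (- (a * (x + y)\<^sup>2))) \<partial>lborel)
    = ennreal (exp (- (a * x\<^sup>2 / (1 + 2 * a * v))) / sqrt (1 + 2 * a * v))"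
proof -
  have w: "1 + 2 * a * v > 0" using v a by (simp add: add_pos_nonneg)
  have "(\<integral>\<^sup>+ y. ennreal (normal_density 0 (sqrt v) y) * ennreal (exp (- (a * (x + y)\<^sup>2))) \<partial>lborel)
    = (\<integral>\<^sup>+ y. ennreal (exp (- (a * x\<^sup>2 / (1 + 2 * a * v))) / sqrt (1 + 2 * a * v)) *
       ennreal (normal_density (- (2 * a * v * x / (1 + 2 * a * v))) (sqrt (v / (1 + 2 * a * v))) y) \<partial>lborel)"
    by (intro nn_integral_cong)
      (simp add: ennreal_mult'[symmetric] normal_density_times_gaussian[OF v a] order.strict_implies_order[OF w])
  also have "\<dots> = ennreal (exp (- (a * x\<^sup>2 / (1 + 2 * a * v))) / sqrt (1 + 2 * a * v)) *
      (\<integral>\<^sup>+ y. ennreal (normal_density (- (2 * a * v * x / (1 + 2 * a * v))) (sqrt (v / (1 + 2 * a * v))) y) \<partial>lborel)"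
    by (rule nn_integral_cmult) measurable
  also have "(\<integral>\<^sup>+ y. ennreal (normal_density (- (2 * a * v * x / (1 + 2 * a * v))) (sqrt (v / (1 + 2 * a * v))) y) \<partial>lborel) = 1"
    using v w by (subst nn_integral_eq_integral) auto
  finally show ?thesis by simp
qed

section \<open>The Laplace transform on a geometric grid\<close>

text \<open>\<^const>\<open>prob_space.indep_var\<close> forces both variables to have the same type;
  independence of a pair and a real variable is therefore stated as factorisation of the joint law.\<close>

lemma (in prob_space) indep_var_distr_pair:
  assumes indep: "indep_var S X T Y" and f: "f \<in> measurable S S'" and g: "g \<in> measurable T T'"
  shows "distr M S' (\<lambda>\<omega>. f (X \<omega>)) \<Otimes>\<^sub>M distr M T' (\<lambda>\<omega>. g (Y \<omega>))
    = distr M (S' \<Otimes>\<^sub>M T') (\<lambda>\<omega>. (f (X \<omega>), g (Y \<omega>)))"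
proof -
  note [measurable] = f g
  have [measurable]: "X \<in> measurable M S" "Y \<in> measurable M T"
    and eq: "distr M S X \<Otimes>\<^sub>M distr M T Y = distr M (S \<Otimes>\<^sub>M T) (\<lambda>\<omega>. (X \<omega>, Y \<omega>))"
    using indep unfolding indep_var_distribution_eq by auto
  interpret T': prob_space "distr M T' (\<lambda>\<omega>. g (Y \<omega>))" by (rule prob_space_distr) measurable
  have X: "distr M S' (\<lambda>\<omega>. f (X \<omega>)) = distr (distr M S X) S' f"
    and Y: "distr M T' (\<lambda>\<omega>. g (Y \<omega>)) = distr (distr M T Y) T' g"
    by (simp_all add: distr_distr comp_def)
  have "distr (distr M S X) S' f \<Otimes>\<^sub>M distr (distr M T Y) T' g
      = distr (distr M S X \<Otimes>\<^sub>M distr M T Y) (S' \<Otimes>\<^sub>M T') (\<lambda>(x, y). (f x, g y))"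
    using T'.sigma_finite_measure_axioms by (intro pair_measure_distr) (auto simp: Y)
  then show ?thesis unfolding X Y eq by (simp add: distr_distr comp_def)
qed

text \<open>By Tonelli on the product law, the increment \<open>V\<close> is integrated out first,
  with the past \<open>(G, S)\<close> held fixed.\<close>

lemma (in prob_space) expectation_gaussian_step:
  fixes G S V :: "'a \<Rightarrow> real"
  assumes [measurable]: "G \<in> borel_measurable M" "S \<in> borel_measurable M" "V \<in> borel_measurable M"
    and eq: "distr M (borel \<Otimes>\<^sub>M borel) (\<lambda>\<omega>. (G \<omega>, S \<omega>)) \<Otimes>\<^sub>M distr M borel V
         = distr M ((borel \<Otimes>\<^sub>M borel) \<Otimes>\<^sub>M borel) (\<lambda>\<omega>. ((G \<omega>, S \<omega>), V \<omega>))"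
    and V: "distributed M lborel V (\<lambda>x. ennreal (normal_density 0 (sqrt v) x))"
    and v: "v > 0" and a: "a \<ge> 0" and G: "\<And>\<omega>. 0 \<le> G \<omega>"
  shows "expectation (\<lambda>\<omega>. G \<omega> * exp (- (a * (S \<omega> + V \<omega>)\<^sup>2)))
    = expectation (\<lambda>\<omega>. G \<omega> * exp (- (a * (S \<omega>)\<^sup>2 / (1 + 2 * a * v)))) / sqrt (1 + 2 * a * v)"
proof -
  let ?Z = "\<lambda>\<omega>. (G \<omega>, S \<omega>)"
  let ?f = "\<lambda>x. ennreal (fst (fst x)) * ennreal (exp (- (a * (snd (fst x) + snd x)\<^sup>2)))"
  interpret DV: prob_space "distr M borel V" by (rule prob_space_distr) measurable
  have inner: "(\<integral>\<^sup>+ y. ennreal (exp (- (a * (s + y)\<^sup>2))) \<partial>distr M borel V)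
      = ennreal (exp (- (a * s\<^sup>2 / (1 + 2 * a * v))) / sqrt (1 + 2 * a * v))" for s
    using distributed_nn_integral[OF V, of "\<lambda>y. ennreal (exp (- (a * (s + y)\<^sup>2)))"]
      nn_integral_normal_gaussian[OF v a, of s]
    by (subst nn_integral_distr) auto
  have "(\<integral>\<^sup>+ \<omega>. ennreal (G \<omega> * exp (- (a * (S \<omega> + V \<omega>)\<^sup>2))) \<partial>M)
      = (\<integral>\<^sup>+ \<omega>. ?f (?Z \<omega>, V \<omega>) \<partial>M)"
    by (simp add: ennreal_mult' G)
  also have "\<dots> = (\<integral>\<^sup>+ x. ?f x \<partial>(distr M (borel \<Otimes>\<^sub>M borel) ?Z \<Otimes>\<^sub>M distr M borel V))"
    unfolding eq by (subst nn_integral_distr) auto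
  also have "\<dots> = (\<integral>\<^sup>+ z. \<integral>\<^sup>+ y. ?f (z, y) \<partial>distr M borel V \<partial>distr M (borel \<Otimes>\<^sub>M borel) ?Z)"
    by (rule DV.nn_integral_fst[symmetric]) simp
  also have "\<dots> = (\<integral>\<^sup>+ z. ennreal (fst z) * (\<integral>\<^sup>+ y. ennreal (exp (- (a * (snd z + y)\<^sup>2))) \<partial>distr M borel V)
      \<partial>distr M (borel \<Otimes>\<^sub>M borel) ?Z)"
    by (intro nn_integral_cong) (simp add: nn_integral_cmult)
  also have "\<dots> = (\<integral>\<^sup>+ \<omega>. ennreal (G \<omega> * exp (- (a * (S \<omega>)\<^sup>2 / (1 + 2 * a * v))) / sqrt (1 + 2 * a * v)) \<partial>M)"
    unfolding inner by (subst nn_integral_distr) (auto simp: ennreal_mult'[symmetric] G)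
  \<comment> \<open>For nonnegative measurable integrands the Bochner integral is determined by the
    nonnegative one, so no integrability of \<open>G\<close> has to be shown.\<close>
  finally have "expectation (\<lambda>\<omega>. G \<omega> * exp (- (a * (S \<omega> + V \<omega>)\<^sup>2)))
    = expectation (\<lambda>\<omega>. G \<omega> * exp (- (a * (S \<omega>)\<^sup>2 / (1 + 2 * a * v))) / sqrt (1 + 2 * a * v))"
    using v a by (subst (1 2) integral_eq_nn_integral) (auto simp: G)
  then show ?thesis by simp
qed

text \<open>The update of the coefficient \<open>s\<close> of \<open>B\<^sub>t\<^sup>2 / t\<close> when the last increment is integrated out,
  with \<open>p = 1 - 1 / \<rho>\<close>.\<close>

definition riccati :: "real \<Rightarrow> real \<Rightarrow> real \<Rightarrow> real" where
  "riccati l p s = (l * p + s) * (1 - p) / (1 + 2 * (l * p + s) * p)"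

section \<open>Brownian increments and the one-step recursion for the grid Laplace transform\<close>

locale brownian_motion = prob_space M for M :: "'a measure" +
  fixes B :: "real \<Rightarrow> 'a \<Rightarrow> real"
  assumes bm: "standard_brownian_motion M B"
begin

lemma measurable_B: "0 \<le> t \<Longrightarrow> B t \<in> borel_measurable M"
  using bm by (simp add: standard_brownian_motion_def)

lemma B_0: "\<omega> \<in> space M \<Longrightarrow> B 0 \<omega> = 0"
  using bm by (simp add: standard_brownian_motion_def)

lemma continuous_B: "\<omega> \<in> space M \<Longrightarrow> continuous_on {0..} (\<lambda>t. B t \<omega>)"
  using bm by (simp add: standard_brownian_motion_def)

lemma distributed_increment:
  "0 \<le> s \<Longrightarrow> s < t \<Longrightarrow>
    distributed M lborel (\<lambda>\<omega>. B t \<omega> - B s \<omega>) (\<lambda>x. ennreal (normal_density 0 (sqrt (t - s)) x))"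
  using bm by (simp add: standard_brownian_motion_def)

text \<open>Joint independence of finitely many increments allows grouping: the block of the first
  \<open>m\<close> is independent of the next one. Both sides are families, as
  \<open>indep_var_restrict\<close> yields them.\<close>

lemma indep_next_increment:
  fixes t :: "nat \<Rightarrow> real"
  assumes t: "strict_mono t" "0 \<le> t 0"
  shows "indep_var (PiM {..<m} (\<lambda>_. borel)) (\<lambda>\<omega>. \<lambda>k\<in>{..<m}. B (t (Suc k)) \<omega> - B (t k) \<omega>)
    (PiM {m} (\<lambda>_. borel)) (\<lambda>\<omega>. \<lambda>k\<in>{m}. B (t (Suc k)) \<omega> - B (t k) \<omega>)"
proof -
  \<comment> \<open>\<open>m + 2\<close> time points give exactly the \<open>m + 1\<close>
    increments with indices \<open>0\<close> to \<open>m\<close>.\<close>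
  define ts where "ts = map t [0..<m + 2]"
  define D where "D = (\<lambda>i \<omega>. B (ts ! Suc i) \<omega> - B (ts ! i) \<omega>)"
  have "sorted_wrt (<) ts"
    using t(1) by (simp add: ts_def sorted_wrt_iff_nth_less strict_mono_less del: upt_Suc)
  moreover have "0 \<le> t k" for k
    using t strict_mono_mono[OF t(1)] by (meson le0 monoD order.trans)
  then have "\<forall>x\<in>set ts. 0 \<le> x" by (auto simp: ts_def)
  ultimately have "indep_vars (\<lambda>_. borel) D {..<length ts - 1}"
    using bm unfolding standard_brownian_motion_def D_def by blast
  then have "indep_vars (\<lambda>_. borel) D {..<Suc m}" by (simp add: ts_def)
  from indep_var_restrict[OF this, of "{..<m}" "{m}"]
  have "indep_var (PiM {..<m} (\<lambda>_. borel)) (\<lambda>\<omega>. restrict (\<lambda>i. D i \<omega>) {..<m})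
      (PiM {m} (\<lambda>_. borel)) (\<lambda>\<omega>. restrict (\<lambda>i. D i \<omega>) {m})" by auto
  moreover have "D k = (\<lambda>\<omega>. B (t (Suc k)) \<omega> - B (t k) \<omega>)" if "k \<le> m" for k
    using that by (simp add: D_def ts_def nth_append del: upt_Suc)
  ultimately show ?thesis
    by (simp cong: restrict_cong)
qed

text \<open>At the right endpoint t = \<open>\<rho> ^ Suc k\<close> the cell length is
  \<open>(1 - 1 / \<rho>) * t\<close>, so the sum is the Riemann sum of
  \<open>B\<^sub>t\<^sup>2 / t\<^sup>2\<close>. The boundary term with coefficient \<open>s\<close>
  makes the family stable under integrating out the last increment.\<close>

definition discrete_laplace :: "real \<Rightarrow> real \<Rightarrow> nat \<Rightarrow> real \<Rightarrow> real" where
  "discrete_laplace l \<rho> m s = expectation (\<lambda>\<omega>.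
     exp (- (l * (1 - 1 / \<rho>) * (\<Sum>k<m. (B (\<rho> ^ Suc k) \<omega>)\<^sup>2 / \<rho> ^ Suc k) + s * ((B (\<rho> ^ m) \<omega>)\<^sup>2 / \<rho> ^ m))))"

text \<open>The last summand merges with the boundary term into the coefficient
  \<open>l * p + s\<close> at time \<open>\<rho> ^ Suc m\<close>. Averaging over the last increment
  produces the square root and moves the boundary term to time \<open>\<rho> ^ m\<close>, with the
  coefficient updated by \<open>riccati\<close>.\<close>

lemma discrete_laplace_Suc:
  assumes \<rho>: "\<rho> > 1" and l: "l \<ge> 0" and s: "s \<ge> 0" and p: "p = 1 - 1 / \<rho>"
  shows "discrete_laplace l \<rho> (Suc m) s
    = discrete_laplace l \<rho> m (riccati l p s) / sqrt (1 + 2 * (l * p + s) * p)"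
proof -
  \<comment> \<open>The times are 0, 1, \<rho>, \<rho>^2 and so on. Starting at 0 makes
    \<open>B (\<rho> ^ k)\<close> the sum of the first \<open>k + 1\<close> increments, which is the
    shift by one in \<open>g\<close> and \<open>h\<close>.\<close>
  define t where "t = (\<lambda>k. case k of 0 \<Rightarrow> 0 | Suc j \<Rightarrow> \<rho> ^ j)"
  have t: "strict_mono t" "0 \<le> t 0"
    using \<rho> by (auto simp: t_def strict_mono_Suc_iff split: nat.splits)
  define D where "D = (\<lambda>\<omega> k. B (t (Suc k)) \<omega> - B (t k) \<omega>)"
  \<comment> \<open>\<open>g\<close> and \<open>h\<close> express the past part of the integrand and
    the value \<open>B (\<rho> ^ m)\<close> through the first \<open>m + 1\<close> increments, so
    that independence applies to them.\<close>
  define g where "g = (\<lambda>x :: nat \<Rightarrow> real. exp (- (l * p * (\<Sum>k<m. (\<Sum>i<Suc (Suc k). x i)\<^sup>2 / \<rho> ^ Suc k))))"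
  define h where "h = (\<lambda>x :: nat \<Rightarrow> real. \<Sum>i<Suc m. x i)"
  have sum_meas[measurable]: "(\<lambda>x. \<Sum>i<k. x i) \<in> borel_measurable (PiM {..<Suc m} (\<lambda>_. borel :: real measure))"
    if "k \<le> Suc m" for k
    using that by (intro borel_measurable_sum measurable_component_singleton) auto
  have [measurable]: "(\<lambda>x. \<Sum>k<m. (\<Sum>i<Suc (Suc k). x i)\<^sup>2 / \<rho> ^ Suc k)
      \<in> borel_measurable (PiM {..<Suc m} (\<lambda>_. borel))"
    by (intro borel_measurable_sum[where S = "{..<m}"] borel_measurable_divide borel_measurable_power
      borel_measurable_const sum_meas) auto
  have [measurable]: "g \<in> borel_measurable (PiM {..<Suc m} (\<lambda>_. borel))"
    unfolding g_def by measurable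
  have [measurable]: "h \<in> borel_measurable (PiM {..<Suc m} (\<lambda>_. borel))"
    unfolding h_def by (rule sum_meas) simp
  define G where "G = (\<lambda>\<omega>. g (restrict (D \<omega>) {..<Suc m}))"
  define S where "S = (\<lambda>\<omega>. h (restrict (D \<omega>) {..<Suc m}))"
  define V where "V = (\<lambda>\<omega>. B (\<rho> ^ Suc m) \<omega> - B (\<rho> ^ m) \<omega>)"
  have tel: "(\<Sum>i<Suc k. D \<omega> i) = B (\<rho> ^ k) \<omega> - B 0 \<omega>" for k \<omega>
    unfolding D_def by (subst sum_lessThan_telescope) (simp add: t_def)
  have indep: "indep_var (PiM {..<Suc m} (\<lambda>_. borel)) (\<lambda>\<omega>. restrict (D \<omega>) {..<Suc m})
      (PiM {Suc m} (\<lambda>_. borel)) (\<lambda>\<omega>. restrict (D \<omega>) {Suc m})"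
    using indep_next_increment[OF t, of "Suc m"] by (simp add: D_def)
  have VD: "V = (\<lambda>\<omega>. restrict (D \<omega>) {Suc m} (Suc m))"
    by (simp add: V_def D_def t_def)
  have law: "distr M (borel \<Otimes>\<^sub>M borel) (\<lambda>\<omega>. (G \<omega>, S \<omega>)) \<Otimes>\<^sub>M distr M borel V
         = distr M ((borel \<Otimes>\<^sub>M borel) \<Otimes>\<^sub>M borel) (\<lambda>\<omega>. ((G \<omega>, S \<omega>), V \<omega>))"
    unfolding G_def S_def VD
    by (rule indep_var_distr_pair[OF indep, of "\<lambda>x. (g x, h x)" _ "\<lambda>x. x (Suc m)"]) measurable
  have Gm: "G \<in> borel_measurable M" and Sm: "S \<in> borel_measurable M"
    unfolding G_def S_def using indep_var_rv1[OF indep] by measurable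
  define v where "v = \<rho> ^ Suc m - \<rho> ^ m"
  have v: "v > 0" using \<rho> by (simp add: v_def)
  have V: "distributed M lborel V (\<lambda>x. ennreal (normal_density 0 (sqrt v) x))"
    unfolding V_def v_def using \<rho> by (intro distributed_increment) auto
  have Vm: "V \<in> borel_measurable M"
    unfolding V_def using \<rho> by (intro borel_measurable_diff measurable_B) auto
  have vp: "v / \<rho> ^ Suc m = p" using \<rho> by (simp add: v_def p field_simps)
  have p01: "0 < p" "p < 1" using \<rho> by (auto simp: p)
  define r where "r = l * p + s"
  have r: "r \<ge> 0" using l s p01 by (simp add: r_def)
  define a where "a = r / \<rho> ^ Suc m"
  have a: "a \<ge> 0" using r \<rho> by (simp add: a_def)
  have av: "a * v = r * p" by (simp add: a_def vp[symmetric])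
  have G_eq: "G \<omega> = exp (- (l * p * (\<Sum>k<m. (B (\<rho> ^ Suc k) \<omega>)\<^sup>2 / \<rho> ^ Suc k)))"
    and S_eq: "S \<omega> = B (\<rho> ^ m) \<omega>" if "\<omega> \<in> space M" for \<omega>
    unfolding G_def S_def g_def h_def using that
    by (auto simp: tel B_0 simp del: sum.lessThan_Suc power_Suc intro!: sum.cong)
  have "discrete_laplace l \<rho> (Suc m) s = expectation (\<lambda>\<omega>. G \<omega> * exp (- (a * (S \<omega> + V \<omega>)\<^sup>2)))"
    unfolding discrete_laplace_def
  proof (rule Bochner_Integration.integral_cong)
    fix \<omega> assume \<omega>: "\<omega> \<in> space M"
    show "exp (- (l * (1 - 1 / \<rho>) * (\<Sum>k<Suc m. (B (\<rho> ^ Suc k) \<omega>)\<^sup>2 / \<rho> ^ Suc k)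
        + s * ((B (\<rho> ^ Suc m) \<omega>)\<^sup>2 / \<rho> ^ Suc m))) = G \<omega> * exp (- (a * (S \<omega> + V \<omega>)\<^sup>2))"
      unfolding G_eq[OF \<omega>] S_eq[OF \<omega>] V_def a_def r_def p exp_add[symmetric]
      by (simp add: add_divide_distrib distrib_left distrib_right del: power_Suc)
  qed simp
  also have "\<dots> = expectation (\<lambda>\<omega>. G \<omega> * exp (- (a * (S \<omega>)\<^sup>2 / (1 + 2 * a * v)))) / sqrt (1 + 2 * a * v)"
    by (rule expectation_gaussian_step[OF Gm Sm Vm law V v a]) (simp add: G_def g_def)
  also have "expectation (\<lambda>\<omega>. G \<omega> * exp (- (a * (S \<omega>)\<^sup>2 / (1 + 2 * a * v)))) = discrete_laplace l \<rho> m (riccati l p s)"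
    unfolding discrete_laplace_def
  proof (rule Bochner_Integration.integral_cong)
    fix \<omega> assume \<omega>: "\<omega> \<in> space M"
    have "a * x / (1 + 2 * a * v) = riccati l p s * (x / \<rho> ^ m)" for x
    proof -
      \<comment> \<open>Rescaling from time \<open>\<rho> ^ Suc m\<close> to
        \<open>\<rho> ^ m\<close> costs the factor 1/\<rho> = \<open>1 - p\<close>.\<close>
      have "a = r * (1 - p) / \<rho> ^ m" using \<rho> by (simp add: a_def p field_simps)
      moreover have "1 + 2 * a * v = 1 + 2 * r * p" using av by (simp add: mult.assoc)
      ultimately show ?thesis by (simp add: riccati_def r_def[symmetric])
    qed
    then show "G \<omega> * exp (- (a * (S \<omega>)\<^sup>2 / (1 + 2 * a * v)))
      = exp (- (l * (1 - 1 / \<rho>) * (\<Sum>k<m. (B (\<rho> ^ Suc k) \<omega>)\<^sup>2 / \<rho> ^ Suc k)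
        + riccati l p s * ((B (\<rho> ^ m) \<omega>)\<^sup>2 / \<rho> ^ m)))"
      unfolding G_eq[OF \<omega>] S_eq[OF \<omega>] exp_add[symmetric] by (simp add: p del: power_Suc)
  qed simp
  also have "1 + 2 * a * v = 1 + 2 * (l * p + s) * p" using av by (simp add: mult.assoc r_def)
  finally show ?thesis .
qed

lemma discrete_laplace_exponent_nonneg:
  assumes "\<rho> \<ge> 1" "l \<ge> 0" "s \<ge> 0"
  shows "0 \<le> l * (1 - 1 / \<rho>) * (\<Sum>k<m. (B (\<rho> ^ Suc k) \<omega>)\<^sup>2 / \<rho> ^ Suc k) + s * ((B (\<rho> ^ m) \<omega>)\<^sup>2 / \<rho> ^ m)"
proof -
  have "0 \<le> (B (\<rho> ^ k) \<omega>)\<^sup>2 / \<rho> ^ k" for k using assms by simp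
  moreover have "1 - 1 / \<rho> \<ge> 0" using assms by simp
  ultimately show ?thesis using assms by (intro add_nonneg_nonneg mult_nonneg_nonneg sum_nonneg) blast+
qed

lemma integrable_discrete_laplace:
  assumes \<rho>: "\<rho> \<ge> 1" and l: "l \<ge> 0" and s: "s \<ge> 0"
  shows "integrable M (\<lambda>\<omega>.
     exp (- (l * (1 - 1 / \<rho>) * (\<Sum>k<m. (B (\<rho> ^ Suc k) \<omega>)\<^sup>2 / \<rho> ^ Suc k) + s * ((B (\<rho> ^ m) \<omega>)\<^sup>2 / \<rho> ^ m))))"
proof (rule integrable_const_bound[where B = 1])
  have [measurable]: "B (\<rho> ^ k) \<in> borel_measurable M" for k using \<rho> by (intro measurable_B) simp
  show "(\<lambda>\<omega>. exp (- (l * (1 - 1 / \<rho>) * (\<Sum>k<m. (B (\<rho> ^ Suc k) \<omega>)\<^sup>2 / \<rho> ^ Suc k) + s * ((B (\<rho> ^ m) \<omega>)\<^sup>2 / \<rho> ^ m))))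
      \<in> borel_measurable M"
    by (simp del: power_Suc)
qed (rule AE_I2, simp only: exp_le_one_iff real_norm_def abs_exp_cancel neg_le_0_iff_le discrete_laplace_exponent_nonneg[OF assms])

lemma discrete_laplace_antimono:
  assumes "\<rho> > 1" "l \<ge> 0" "0 \<le> s" "s \<le> s'"
  shows "discrete_laplace l \<rho> m s' \<le> discrete_laplace l \<rho> m s"
proof -
  have "0 \<le> (B (\<rho> ^ m) \<omega>)\<^sup>2 / \<rho> ^ m" for \<omega> using assms by simp
  then show ?thesis
    unfolding discrete_laplace_def exp_le_cancel_iff neg_le_iff_le
    by (intro integral_mono integrable_discrete_laplace order.strict_implies_order[OF assms(1)], unfold exp_le_cancel_iff neg_le_iff_le)
      (use assms in \<open>auto intro!: add_left_mono mult_right_mono simp del: times_divide_eq_right\<close>)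
qed

lemma discrete_laplace_le_1:
  assumes "\<rho> > 1" "l \<ge> 0" "0 \<le> s"
  shows "discrete_laplace l \<rho> m s \<le> 1"
  unfolding discrete_laplace_def
  by (intro integral_le_const integrable_discrete_laplace order.strict_implies_order[OF assms(1)] assms)
    (rule AE_I2, simp only: exp_le_one_iff neg_le_0_iff_le discrete_laplace_exponent_nonneg[OF order.strict_implies_order[OF assms(1)] assms(2,3)])

text \<open>The sum is empty, and \<open>B 1\<close> is standard normal because paths start at
  0.\<close>

lemma discrete_laplace_0:
  assumes "\<rho> > 1" "l \<ge> 0" "0 \<le> s"
  shows "discrete_laplace l \<rho> 0 s = 1 / sqrt (1 + 2 * s)"
proof -
  have "distributed M lborel (\<lambda>\<omega>. B 1 \<omega> - B 0 \<omega>) (\<lambda>x. ennreal (normal_density 0 (sqrt 1) x))"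
    using distributed_increment[of 0 1] by simp
  from distributed_nn_integral[OF this, of "\<lambda>y. ennreal (exp (- (s * (0 + y)\<^sup>2)))"]
  have "(\<integral>\<^sup>+\<omega>. ennreal (exp (- (s * (0 + (B 1 \<omega> - B 0 \<omega>))\<^sup>2))) \<partial>M) = ennreal (1 / sqrt (1 + 2 * s))"
    using nn_integral_normal_gaussian[of 1 s 0] assms by simp
  also have "(\<integral>\<^sup>+\<omega>. ennreal (exp (- (s * (0 + (B 1 \<omega> - B 0 \<omega>))\<^sup>2))) \<partial>M) = (\<integral>\<^sup>+\<omega>. ennreal (exp (- (s * (B 1 \<omega>)\<^sup>2))) \<partial>M)"
    by (intro nn_integral_cong) (simp add: B_0)
  finally show ?thesis
    unfolding discrete_laplace_def using assms measurable_B[of 1] by (subst integral_eq_nn_integral) auto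
qed
end

section \<open>The Riccati iteration\<close>

lemma riccati_nonneg:
  "0 \<le> l \<Longrightarrow> 0 < p \<Longrightarrow> p < 1 \<Longrightarrow> 0 \<le> s \<Longrightarrow> 0 \<le> riccati l p s"
  by (simp add: riccati_def)

text \<open>In terms of \<open>r = l * p + s\<close> this is monotonicity of
  \<open>r / (1 + 2 * r * p)\<close>.\<close>

lemma riccati_mono:
  assumes "0 \<le> l" "0 < p" "p < 1" "0 \<le> s" "s \<le> s'"
  shows "riccati l p s \<le> riccati l p s'"
proof -
  define r r' where "r = l * p + s" and "r' = l * p + s'"
  have r: "0 \<le> r" "r \<le> r'" using assms by (auto simp: r_def r'_def)
  have "r * (1 + 2 * r' * p) \<le> r' * (1 + 2 * r * p)" using r by (simp add: algebra_simps)
  moreover have "0 < 1 + 2 * r * p" "0 < 1 + 2 * r' * p"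
    using r assms by (auto intro!: add_pos_nonneg)
  ultimately have "r / (1 + 2 * r * p) \<le> r' / (1 + 2 * r' * p)" by (simp add: divide_simps)
  then have "r / (1 + 2 * r * p) * (1 - p) \<le> r' / (1 + 2 * r' * p) * (1 - p)"
    using assms by (intro mult_right_mono) auto
  then show ?thesis by (simp add: riccati_def r_def r'_def)
qed

text \<open>Such an \<open>s\<close> is a supersolution: after clearing denominators and cancelling
  \<open>p\<close> the claim is \<open>l \<le> r + 2 * r * s\<close>, which follows from
  \<open>s \<le> r\<close>.\<close>

lemma riccati_le_self:
  assumes "0 \<le> l" "0 < p" "p < 1" "0 \<le> s" "l \<le> s + 2 * s\<^sup>2"
  shows "riccati l p s \<le> s"
proof -
  define r where "r = l * p + s"
  have r: "s \<le> r" using assms by (simp add: r_def)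
  have "s * s \<le> r * s" using r assms by (intro mult_right_mono) auto
  then have "p * l \<le> p * (r + 2 * r * s)"
    using r assms by (intro mult_left_mono) (auto simp: power2_eq_square)
  then have "r * (1 - p) \<le> s * (1 + 2 * r * p)" by (simp add: r_def algebra_simps)
  moreover have "0 < 1 + 2 * r * p" using r assms by (auto intro!: add_pos_nonneg)
  ultimately show ?thesis by (simp add: riccati_def r_def[symmetric] divide_simps)
qed

text \<open>Up to \<sigma> each iteration gains at least \<open>\<kappa> * p\<close>. Clearing
  denominators, the claim is \<open>\<kappa> * (1 + 2 * r * p) + r * (1 + 2 * s) \<le> l\<close>,
  and the last hypothesis is its worst case \<open>s = \<sigma>\<close>. As \<open>p\<close> tends
  to 0 that hypothesis becomes
  \<open>\<kappa> + \<sigma> + 2 * \<sigma>\<^sup>2 \<le> l\<close>.\<close>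

lemma riccati_ge_add:
  assumes "0 \<le> l" "0 < p" "p < 1" "0 \<le> s" "s \<le> \<sigma>" "0 \<le> \<kappa>"
    and \<kappa>: "\<kappa> * (1 + 2 * (l * p + \<sigma>) * p) + (l * p + \<sigma>) * (1 + 2 * \<sigma>) \<le> l"
  shows "s + \<kappa> * p \<le> riccati l p s"
proof -
  define r where "r = l * p + s"
  have r: "0 \<le> r" "r \<le> l * p + \<sigma>" using assms by (auto simp: r_def)
  have "\<kappa> * (1 + 2 * r * p) + r * (1 + 2 * s)
      \<le> \<kappa> * (1 + 2 * (l * p + \<sigma>) * p) + (l * p + \<sigma>) * (1 + 2 * \<sigma>)"
    using r assms by (intro add_mono mult_mono mult_left_mono mult_right_mono) auto
  then have "p * (\<kappa> * (1 + 2 * r * p) + r * (1 + 2 * s)) \<le> p * l"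
    using \<kappa> assms by (intro mult_left_mono) auto
  then have "(s + \<kappa> * p) * (1 + 2 * r * p) \<le> r * (1 - p)" by (simp add: r_def algebra_simps)
  moreover have "0 < 1 + 2 * r * p" using r assms by (auto intro!: add_pos_nonneg)
  ultimately show ?thesis by (simp add: riccati_def r_def[symmetric] divide_simps)
qed

section \<open>Bounds on the grid Laplace transform from sub- and supersolutions\<close>

context brownian_motion
begin

text \<open>The iteration does not raise a supersolution \<open>s\<close>. Since the transform
  decreases in the boundary coefficient, that coefficient may be reset to \<open>s\<close> after
  every step, and each step costs the same factor.\<close>

lemma discrete_laplace_lower:
  assumes \<rho>: "\<rho> > 1" and l: "l \<ge> 0" and s: "s \<ge> 0" and ls: "l \<le> s + 2 * s\<^sup>2" and p: "p = 1 - 1 / \<rho>"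
  shows "(1 / sqrt (1 + 2 * (l * p + s) * p)) ^ m / sqrt (1 + 2 * s) \<le> discrete_laplace l \<rho> m s"
proof (induction m)
  case 0
  then show ?case using assms by (simp add: discrete_laplace_0)
next
  case (Suc m)
  have p01: "0 < p" "p < 1" using \<rho> by (auto simp: p)
  define w where "w = sqrt (1 + 2 * (l * p + s) * p)"
  have w: "w > 0" unfolding w_def using l s p01 by (auto intro!: add_pos_nonneg)
  have "(1 / w) ^ Suc m / sqrt (1 + 2 * s) = ((1 / w) ^ m / sqrt (1 + 2 * s)) / w" by simp
  also have "\<dots> \<le> discrete_laplace l \<rho> m s / w"
    using Suc w by (intro divide_right_mono) (auto simp: w_def)
  also have "\<dots> \<le> discrete_laplace l \<rho> m (riccati l p s) / w"
    using w by (intro divide_right_mono discrete_laplace_antimono \<rho> l riccati_nonneg s p01 riccati_le_self ls) auto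
  also have "\<dots> = discrete_laplace l \<rho> (Suc m) s"
    by (simp add: discrete_laplace_Suc[OF \<rho> l s p] w_def)
  finally show ?case by (simp add: w_def)
qed

lemma discrete_laplace_upper_step:
  assumes \<rho>: "\<rho> > 1" and l: "l \<ge> 0" and s: "s \<ge> 0" and p: "p = 1 - 1 / \<rho>"
  shows "discrete_laplace l \<rho> (Suc m) s \<le> discrete_laplace l \<rho> m (riccati l p s) / sqrt (1 + 2 * s * p)"
proof -
  have p01: "0 < p" "p < 1" using \<rho> by (auto simp: p)
  have "0 \<le> discrete_laplace l \<rho> m (riccati l p s)"
    unfolding discrete_laplace_def by (rule Bochner_Integration.integral_nonneg) simp
  then show ?thesis
    unfolding discrete_laplace_Suc[OF \<rho> l s p] using p01 l s
    by (intro divide_left_mono mult_pos_pos) (auto intro!: add_pos_nonneg mult_right_mono)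
qed

text \<open>Coefficients at or above the subsolution \<sigma> stay there, so every step contributes
  at most the factor \<open>1 / sqrt (1 + 2 * \<sigma> * p)\<close>.\<close>

lemma discrete_laplace_upper_stationary:
  assumes \<rho>: "\<rho> > 1" and l: "l \<ge> 0" and p: "p = 1 - 1 / \<rho>"
    and \<sigma>: "0 \<le> \<sigma>" "\<sigma> \<le> riccati l p \<sigma>" and s: "\<sigma> \<le> s"
  shows "discrete_laplace l \<rho> m s \<le> (1 / sqrt (1 + 2 * \<sigma> * p)) ^ m"
  using s
proof (induction m arbitrary: s)
  case 0
  then show ?case using discrete_laplace_le_1[OF \<rho> l, of s 0] \<sigma> by simp
next
  case (Suc m)
  have p01: "0 < p" "p < 1" using \<rho> by (auto simp: p)
  have s: "0 \<le> s" using Suc \<sigma> by simp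
  have w: "0 < sqrt (1 + 2 * \<sigma> * p)" using \<sigma> p01 by (auto intro!: add_pos_nonneg)
  have ric: "\<sigma> \<le> riccati l p s"
    using \<sigma>(2) riccati_mono[OF l p01 \<sigma>(1) Suc.prems] by simp
  have "discrete_laplace l \<rho> (Suc m) s \<le> discrete_laplace l \<rho> m (riccati l p s) / sqrt (1 + 2 * s * p)"
    by (rule discrete_laplace_upper_step[OF \<rho> l s p])
  also have "\<dots> \<le> (1 / sqrt (1 + 2 * \<sigma> * p)) ^ m / sqrt (1 + 2 * \<sigma> * p)"
    using w Suc.prems p01 by (intro frac_le Suc.IH[OF ric]) (auto intro!: mult_right_mono)
  finally show ?case by (simp add: mult.commute)
qed

text \<open>During \<open>i\<close> warm-up steps the factors are merely bounded by 1 while the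
  coefficient climbs by \<open>\<kappa> * p\<close> per step; once it has reached \<sigma>, the
  stationary bound covers the other \<open>m\<close> steps. The number \<open>j\<close> counts
  climbs already made, which lets the induction carry the progress; it starts at 0.\<close>

lemma discrete_laplace_upper:
  assumes \<rho>: "\<rho> > 1" and l: "l \<ge> 0" and p: "p = 1 - 1 / \<rho>" and \<sigma>: "0 \<le> \<sigma>" and \<kappa>0: "0 \<le> \<kappa>"
    and \<kappa>: "\<kappa> * (1 + 2 * (l * p + \<sigma>) * p) + (l * p + \<sigma>) * (1 + 2 * \<sigma>) \<le> l"
    and j: "\<sigma> \<le> \<kappa> * p * (real i + real j)" and s: "min \<sigma> (\<kappa> * p * real j) \<le> s"
  shows "discrete_laplace l \<rho> (i + m) s \<le> (1 / sqrt (1 + 2 * \<sigma> * p)) ^ m"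
  using j s
proof (induction i arbitrary: j s)
  have p01: "0 < p" "p < 1" using \<rho> by (auto simp: p)
  {
    case 0
    have "\<sigma> \<le> riccati l p \<sigma>"
      using riccati_ge_add[OF l p01 \<sigma> order.refl \<kappa>0 \<kappa>] \<kappa>0 p01
      by (meson add_increasing2 order.refl order.trans less_imp_le mult_nonneg_nonneg)
    then show ?case
      using 0 \<sigma> by (simp add: discrete_laplace_upper_stationary[OF \<rho> l p])
  next
    case (Suc i)
    define s0 where "s0 = min \<sigma> (\<kappa> * p * real j)"
    have s0: "0 \<le> s0" "s0 \<le> \<sigma>" "s0 \<le> s"
      using Suc.prems \<sigma> \<kappa>0 p01 by (auto simp: s0_def)
    \<comment> \<open>The climb is guaranteed only up to \<sigma>, hence the truncation.\<close>
    have "min \<sigma> (a + b) \<le> min \<sigma> a + b" if "0 \<le> b" for a b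
      using that by (auto simp: min_def)
    from this[of "\<kappa> * p" "\<kappa> * p * real j"]
    have "min \<sigma> (\<kappa> * p * real (Suc j)) \<le> s0 + \<kappa> * p"
      using \<kappa>0 p01 by (simp add: s0_def distrib_left add.commute)
    also have "\<dots> \<le> riccati l p s0"
      by (rule riccati_ge_add[OF l p01 s0(1,2) \<kappa>0 \<kappa>])
    also have "\<dots> \<le> riccati l p s"
      by (rule riccati_mono[OF l p01 s0(1,3)])
    finally have IH: "discrete_laplace l \<rho> (i + m) (riccati l p s) \<le> (1 / sqrt (1 + 2 * \<sigma> * p)) ^ m"
      using Suc.prems by (intro Suc.IH[of "Suc j"]) (auto simp: algebra_simps)
    have s: "0 \<le> s" using s0 by simp
    have "discrete_laplace l \<rho> (Suc i + m) s \<le> discrete_laplace l \<rho> (i + m) (riccati l p s) / sqrt (1 + 2 * s * p)"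
      using discrete_laplace_upper_step[OF \<rho> l s p, of "i + m"] by simp
    also have "\<dots> \<le> (1 / sqrt (1 + 2 * \<sigma> * p)) ^ m / 1"
      using IH s \<sigma> p01 by (intro frac_le) auto
    finally show ?case by simp
  }
qed

section \<open>The Laplace transform of the integral\<close>

lemma riemann_sum_tendsto_Lhat:
  assumes n: "1 \<le> n" and \<omega>: "\<omega> \<in> space M"
  shows "(\<lambda>N. (1 - 1 / exp (ln n / N)) * (\<Sum>k<N. (B (exp (ln n / N) ^ Suc k) \<omega>)\<^sup>2 / exp (ln n / N) ^ Suc k))
    \<longlonglongrightarrow> Lhat B n \<omega>"
proof -
  have "continuous_on {1..n} (\<lambda>t. (B t \<omega>)\<^sup>2 / t\<^sup>2)"
    by (intro continuous_intros continuous_on_subset[OF continuous_B[OF \<omega>]]) auto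
  from geometric_riemann_sum_tendsto[OF this n]
  have "(\<lambda>N. \<Sum>k<N. (B (exp (ln n / N) ^ Suc k) \<omega>)\<^sup>2 / (exp (ln n / N) ^ Suc k)\<^sup>2
      * (exp (ln n / N) ^ Suc k - exp (ln n / N) ^ k)) \<longlonglongrightarrow> Lhat B n \<omega>"
    by (simp add: Lhat_def)
  moreover have "b / (r ^ Suc k)\<^sup>2 * (r ^ Suc k - r ^ k) = (1 - 1 / r) * (b / r ^ Suc k)" if "r > 0" for b r :: real and k
    using that by (simp add: field_simps power2_eq_square)
  ultimately show ?thesis by (simp add: sum_distrib_left del: power_Suc)
qed

text \<open>As a pointwise limit of Riemann sums, each a function of finitely many
  \<open>B t\<close>; joint measurability of the process is thereby avoided.\<close>

lemma measurable_Lhat: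
  assumes n: "1 \<le> n"
  shows "Lhat B n \<in> borel_measurable M"
proof (rule borel_measurable_LIMSEQ_real[OF riemann_sum_tendsto_Lhat[OF n]])
  fix N :: nat
  have [measurable]: "B (exp (ln n / N) ^ k) \<in> borel_measurable M" for k by (intro measurable_B) simp
  show "(\<lambda>\<omega>. (1 - 1 / exp (ln n / N)) * (\<Sum>k<N. (B (exp (ln n / N) ^ Suc k) \<omega>)\<^sup>2 / exp (ln n / N) ^ Suc k))
      \<in> borel_measurable M" by (simp del: power_Suc)
qed

text \<open>The claim covers \<open>\<omega>\<close> outside \<open>space M\<close>, where the path
  may fail to be continuous; a nonexistent integral has the default value 0.\<close>

lemma Lhat_nonneg: "0 \<le> Lhat B n \<omega>"
proof (cases "(\<lambda>t. (B t \<omega>)\<^sup>2 / t\<^sup>2) integrable_on {1..n}")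
  case True
  then show ?thesis unfolding Lhat_def by (rule Henstock_Kurzweil_Integration.integral_nonneg) simp
next
  case False
  then show ?thesis by (simp add: Lhat_def not_integrable_integral)
qed

lemma integrable_exp_Lhat:
  assumes "1 \<le> n" "0 \<le> l"
  shows "integrable M (\<lambda>\<omega>. exp (- (l * Lhat B n \<omega>)))"
  using measurable_Lhat[OF assms(1)] assms
  by (intro integrable_const_bound[where B = 1]) (auto simp: Lhat_nonneg)

text \<open>Dominated convergence with bound 1 along the Riemann sums; the boundary coefficient is
  0, so only the integral survives.\<close>

lemma discrete_laplace_tendsto:
  assumes n: "1 \<le> n" and l: "0 \<le> l"
  shows "(\<lambda>N. discrete_laplace l (exp (ln n / N)) N 0) \<longlonglongrightarrow> expectation (\<lambda>\<omega>. exp (- (l * Lhat B n \<omega>)))"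
  unfolding discrete_laplace_def
proof (rule integral_dominated_convergence[where w = "\<lambda>_. 1"])
  have \<rho>: "1 \<le> exp (ln n / real N)" for N using n by simp
  show "(\<lambda>\<omega>. exp (- (l * Lhat B n \<omega>))) \<in> borel_measurable M"
    using measurable_Lhat[OF n] by simp
  show "AE \<omega> in M. (\<lambda>N. exp (- (l * (1 - 1 / exp (ln n / N)) * (\<Sum>k<N. (B (exp (ln n / N) ^ Suc k) \<omega>)\<^sup>2 / exp (ln n / N) ^ Suc k)
      + 0 * ((B (exp (ln n / N) ^ N) \<omega>)\<^sup>2 / exp (ln n / N) ^ N)))) \<longlonglongrightarrow> exp (- (l * Lhat B n \<omega>))"
  proof (rule AE_I2)
    fix \<omega> assume "\<omega> \<in> space M"
    from riemann_sum_tendsto_Lhat[OF n this]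
    show "(\<lambda>N. exp (- (l * (1 - 1 / exp (ln n / N)) * (\<Sum>k<N. (B (exp (ln n / N) ^ Suc k) \<omega>)\<^sup>2 / exp (ln n / N) ^ Suc k)
      + 0 * ((B (exp (ln n / N) ^ N) \<omega>)\<^sup>2 / exp (ln n / N) ^ N)))) \<longlonglongrightarrow> exp (- (l * Lhat B n \<omega>))"
      unfolding mult_zero_left add_0_right mult.assoc by (intro tendsto_intros)
  qed
  show "(\<lambda>\<omega>. exp (- (l * (1 - 1 / exp (ln n / N)) * (\<Sum>k<N. (B (exp (ln n / N) ^ Suc k) \<omega>)\<^sup>2 / exp (ln n / N) ^ Suc k)
      + 0 * ((B (exp (ln n / N) ^ N) \<omega>)\<^sup>2 / exp (ln n / N) ^ N)))) \<in> borel_measurable M" for N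
    by (intro borel_measurable_integrable integrable_discrete_laplace \<rho> l order.refl)
  show "AE \<omega> in M. norm (exp (- (l * (1 - 1 / exp (ln n / N)) * (\<Sum>k<N. (B (exp (ln n / N) ^ Suc k) \<omega>)\<^sup>2 / exp (ln n / N) ^ Suc k)
      + 0 * ((B (exp (ln n / N) ^ N) \<omega>)\<^sup>2 / exp (ln n / N) ^ N)))) \<le> 1" for N
    by (rule AE_I2, simp only: exp_le_one_iff real_norm_def abs_exp_cancel neg_le_0_iff_le
      discrete_laplace_exponent_nonneg[OF \<rho> l order.refl])
qed simp

text \<open>The supersolution bound on the grid of \<open>N\<close> cells has factors at least
  \<open>exp (- (r * h))\<close> with \<open>h = ln n / N\<close> and \<open>r = l * p + s\<close>.
  Together they give \<open>exp (- (r * ln n))\<close>, and \<open>r\<close> tends to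
  \<open>s\<close> as the mesh shrinks.\<close>

lemma laplace_Lhat_lower:
  assumes n: "1 < n" and l: "0 \<le> l" and s: "0 \<le> s" and ls: "l \<le> s + 2 * s\<^sup>2"
  shows "n powr (- s) / sqrt (1 + 2 * s) \<le> expectation (\<lambda>\<omega>. exp (- (l * Lhat B n \<omega>)))"
proof (rule LIMSEQ_le)
  define T where "T = ln n"
  have T: "T > 0" using n by (simp add: T_def)
  show "(\<lambda>N. discrete_laplace l (exp (ln n / N)) N 0) \<longlonglongrightarrow> expectation (\<lambda>\<omega>. exp (- (l * Lhat B n \<omega>)))"
    using n l by (intro discrete_laplace_tendsto) auto
  have "(\<lambda>N. exp (- ((l * (1 - 1 / exp (T / real N)) + s) * T)) / sqrt (1 + 2 * s))
      \<longlonglongrightarrow> exp (- ((l * (1 - 1 / exp 0) + s) * T)) / sqrt (1 + 2 * s)"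
    using s by (intro tendsto_intros lim_const_over_n) auto
  then show "(\<lambda>N. exp (- ((l * (1 - 1 / exp (T / real N)) + s) * T)) / sqrt (1 + 2 * s))
      \<longlonglongrightarrow> n powr (- s) / sqrt (1 + 2 * s)"
    using n by (simp add: powr_def T_def)
  show "\<exists>N0. \<forall>N\<ge>N0. exp (- ((l * (1 - 1 / exp (T / real N)) + s) * T)) / sqrt (1 + 2 * s)
      \<le> discrete_laplace l (exp (ln n / N)) N 0"
  proof (intro exI allI impI)
    fix N :: nat assume N: "1 \<le> N"
    define h where "h = T / N"
    define p where "p = 1 - 1 / exp h"
    define r where "r = l * p + s"
    have h: "h > 0" using T N by (simp add: h_def)
    have Nh: "real N * h = T" using N by (simp add: h_def)
    have p: "0 < p" "p < 1" "p \<le> h"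
      using h exp_ge_add_one_self[of "- h"] by (auto simp: p_def exp_minus inverse_eq_divide)
    have r: "0 \<le> r" using l s p by (simp add: r_def)
    have "sqrt (1 + 2 * r * p) \<le> exp (r * h)"
    proof (rule real_le_lsqrt)
      have "1 + 2 * r * p \<le> 1 + 2 * (r * h)" using p r by (simp add: mult_left_mono)
      also have "\<dots> \<le> exp (2 * (r * h))" by (rule exp_ge_add_one_self)
      finally show "1 + 2 * r * p \<le> (exp (r * h))\<^sup>2" by (simp add: exp_double)
    qed (use r p in auto)
    then have "1 / exp (r * h) \<le> 1 / sqrt (1 + 2 * r * p)"
      using r p by (intro divide_left_mono mult_pos_pos) (auto intro!: add_pos_nonneg)
    then have "(1 / exp (r * h)) ^ N \<le> (1 / sqrt (1 + 2 * r * p)) ^ N"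
      by (intro power_mono) auto
    also have "(1 / exp (r * h)) ^ N = exp (- (r * T))"
      by (simp add: power_one_over exp_minus inverse_eq_divide Nh[symmetric] exp_of_nat_mult[symmetric] mult_ac)
    finally have "exp (- (r * T)) / sqrt (1 + 2 * s) \<le> (1 / sqrt (1 + 2 * r * p)) ^ N / sqrt (1 + 2 * s)"
      using s by (intro divide_right_mono) auto
    also have "\<dots> \<le> discrete_laplace l (exp h) N s"
      unfolding r_def using h by (intro discrete_laplace_lower l s ls) (auto simp: p_def)
    \<comment> \<open>The boundary coefficient \<open>s\<close> served only to keep the recursion
      stationary; removing it increases the transform.\<close>
    also have "\<dots> \<le> discrete_laplace l (exp h) N 0"
      using h by (intro discrete_laplace_antimono l s) auto
    finally show "exp (- ((l * (1 - 1 / exp (T / real N)) + s) * T)) / sqrt (1 + 2 * s)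
      \<le> discrete_laplace l (exp (ln n / N)) N 0"
      by (simp add: r_def p_def h_def T_def)
  qed
qed

text \<open>The warm-up takes about \<open>\<sigma> / (\<kappa> * p)\<close> steps, a stretch of
  logarithmic time tending to \<sigma>/\<kappa> whatever \<open>n\<close> is. It therefore costs
  only the constant \<open>exp (\<sigma>\<^sup>2 / \<kappa>)\<close>.\<close>

lemma laplace_Lhat_upper:
  assumes \<sigma>: "0 \<le> \<sigma>" "\<sigma> + 2 * \<sigma>\<^sup>2 < l"
  obtains C where "C > 0" "\<And>n. 1 < n \<Longrightarrow> expectation (\<lambda>\<omega>. exp (- (l * Lhat B n \<omega>))) \<le> C * n powr (- \<sigma>)"
proof
  \<comment> \<open>Half of the slack in the hypothesis: the limiting form of the condition on
    \<kappa> is then strict, so the condition holds on all fine grids.\<close>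
  define \<kappa> where "\<kappa> = (l - \<sigma> - 2 * \<sigma>\<^sup>2) / 2"
  have \<kappa>: "\<kappa> > 0" using \<sigma> by (simp add: \<kappa>_def)
  have l: "0 \<le> l" using \<sigma> by (smt (verit) zero_le_power2)
  show "exp (\<sigma>\<^sup>2 / \<kappa>) > 0" by simp
  fix n :: real assume n: "1 < n"
  define T where "T = ln n"
  have T: "T > 0" using n by (simp add: T_def)
  define p where "p = (\<lambda>N. 1 - 1 / exp (T / real N))"
  have p01: "0 < p N" "p N < 1" if "N \<ge> 1" for N
    using T that by (auto simp: p_def)
  have "p \<longlonglongrightarrow> 1 - 1 / exp 0"
    unfolding p_def by (intro tendsto_intros lim_const_over_n) auto
  then have p0: "p \<longlonglongrightarrow> 0" by simp
  \<comment> \<open>The punctured filter is required because difference quotients at 0 are composed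
    with \<open>p\<close> below.\<close>
  have p0': "filterlim p (at 0) sequentially"
    using p0 p01 by (auto simp: filterlim_at eventually_sequentially intro!: exI[of _ 1]) (metis less_irrefl)
  have Np: "(\<lambda>N. real N * p N) \<longlonglongrightarrow> T"
  proof -
    have "((\<lambda>h. 1 - exp (- h)) has_field_derivative 1) (at (0::real))"
      by (auto intro!: derivative_eq_intros)
    then have "((\<lambda>h. (1 - exp (- h)) / h) \<longlongrightarrow> 1) (at (0::real))"
      by (simp add: DERIV_def)
    moreover have "filterlim (\<lambda>N. T / real N) (at 0) sequentially"
      using lim_const_over_n[of T] T by (auto simp: filterlim_at eventually_sequentially intro!: exI[of _ 1])
    ultimately have "(\<lambda>N. (1 - exp (- (T / real N))) / (T / real N)) \<longlonglongrightarrow> 1"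
      by (rule filterlim_compose)
    then have "(\<lambda>N. T * ((1 - exp (- (T / real N))) / (T / real N))) \<longlonglongrightarrow> T * 1"
      by (intro tendsto_intros)
    then show ?thesis using T by (simp add: p_def exp_minus inverse_eq_divide mult.commute)
  qed
  have lnp: "(\<lambda>N. ln (1 + 2 * \<sigma> * p N) / p N) \<longlonglongrightarrow> 2 * \<sigma>"
  proof -
    have "((\<lambda>h. ln (1 + 2 * \<sigma> * h)) has_field_derivative 2 * \<sigma>) (at (0::real))"
      by (auto intro!: derivative_eq_intros)
    then have "((\<lambda>h. ln (1 + 2 * \<sigma> * h) / h) \<longlongrightarrow> 2 * \<sigma>) (at (0::real))"
      by (simp add: DERIV_def)
    from filterlim_compose[OF this p0'] show ?thesis .
  qed
  \<comment> \<open>The logarithm of the grid bound with the number of stationary steps replaced by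
    its lower estimate \<open>N - \<sigma> / (\<kappa> * p N) - 1\<close>, arranged as a product of
    convergent factors.\<close>
  define E where "E = (\<lambda>N. - ((real N * p N - \<sigma> / \<kappa> - p N) / 2 * (ln (1 + 2 * \<sigma> * p N) / p N)))"
  have "E \<longlonglongrightarrow> - ((T - \<sigma> / \<kappa> - 0) / 2 * (2 * \<sigma>))"
    unfolding E_def by (intro tendsto_intros Np lnp p0) auto
  then have E: "(\<lambda>N. exp (E N)) \<longlonglongrightarrow> exp (- ((T - \<sigma> / \<kappa> - 0) / 2 * (2 * \<sigma>)))"
    by (rule tendsto_exp)
  have "(\<lambda>N. \<kappa> * (1 + 2 * (l * p N + \<sigma>) * p N) + (l * p N + \<sigma>) * (1 + 2 * \<sigma>))
      \<longlonglongrightarrow> \<kappa> * (1 + 2 * (l * 0 + \<sigma>) * 0) + (l * 0 + \<sigma>) * (1 + 2 * \<sigma>)"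
    by (intro tendsto_intros p0)
  moreover have "\<kappa> * (1 + 2 * (l * 0 + \<sigma>) * 0) + (l * 0 + \<sigma>) * (1 + 2 * \<sigma>) < l"
    using \<kappa> by (simp add: \<kappa>_def power2_eq_square field_simps)
  ultimately have "\<forall>\<^sub>F N in sequentially. \<kappa> * (1 + 2 * (l * p N + \<sigma>) * p N) + (l * p N + \<sigma>) * (1 + 2 * \<sigma>) < l"
    by (rule order_tendstoD)
  then have ev: "\<forall>\<^sub>F N in sequentially. discrete_laplace l (exp (ln n / N)) N 0 \<le> exp (E N)"
    using eventually_ge_at_top[of 1]
  proof eventually_elim
    case (elim N)
    note p = p01[OF elim(2)]
    have \<rho>: "exp (ln n / N) > 1" using T elim by (simp add: T_def)
    have pe: "p N = 1 - 1 / exp (ln n / N)" by (simp add: p_def T_def)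
    \<comment> \<open>The least number of warm-up steps that brings the coefficient from 0 to
      \<sigma>.\<close>
    define J where "J = nat \<lceil>\<sigma> / (\<kappa> * p N)\<rceil>"
    have q: "0 \<le> \<sigma> / (\<kappa> * p N)" using \<sigma> \<kappa> p by simp
    have J: "\<sigma> / (\<kappa> * p N) \<le> real J" "real J \<le> \<sigma> / (\<kappa> * p N) + 1"
      using q unfolding J_def by linarith+
    define y where "y = ln (1 + 2 * \<sigma> * p N)"
    have w: "1 + 2 * \<sigma> * p N \<ge> 1" using \<sigma> p by simp
    have y: "y \<ge> 0" using w by (simp add: y_def)
    have Ey: "E N = - ((real N - \<sigma> / (\<kappa> * p N) - 1) / 2 * y)"
      using p \<kappa> by (simp add: E_def y_def field_simps)
    show ?case
    proof (cases "J \<le> N")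
      case True
      then obtain m where m: "N = J + m" using le_Suc_ex by blast
      have "discrete_laplace l (exp (ln n / N)) (J + m) 0 \<le> (1 / sqrt (1 + 2 * \<sigma> * p N)) ^ m"
        using elim(1) J(1) \<kappa> p \<sigma>
        by (intro discrete_laplace_upper[OF \<rho> l pe \<sigma>(1), where \<kappa> = \<kappa> and j = 0]) (auto simp: field_simps)
      also have "1 / sqrt (1 + 2 * \<sigma> * p N) = exp (- (y / 2))"
      proof -
        have "sqrt (1 + 2 * \<sigma> * p N) = exp (y / 2)"
          using w by (intro real_sqrt_unique) (auto simp: y_def exp_double[symmetric])
        then show ?thesis by (simp add: exp_minus inverse_eq_divide)
      qed
      also have "exp (- (y / 2)) ^ m = exp (- (real m * (y / 2)))"
        by (simp add: exp_of_nat_mult[symmetric])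
      also have "\<dots> \<le> exp (E N)"
      proof -
        have "(real N - \<sigma> / (\<kappa> * p N) - 1) * (y / 2) \<le> real m * (y / 2)"
          using J(2) m y by (intro mult_right_mono) auto
        then show ?thesis by (simp add: Ey)
      qed
      finally show ?thesis using m by simp
    next
      \<comment> \<open>If the grid is shorter than the warm-up, \<open>E N\<close> is nonnegative
        and the trivial bound 1 is enough.\<close>
      case False
      then have "real N + 1 \<le> real J" by simp
      then have "real N - \<sigma> / (\<kappa> * p N) - 1 \<le> 0" using J by linarith
      then have "E N \<ge> 0" using y by (simp add: Ey mult_nonpos_nonneg)
      then have "1 \<le> exp (E N)" by simp
      with discrete_laplace_le_1[OF \<rho> l, of 0 N] show ?thesis by (meson order.refl order.trans)
    qed
  qed
  have "expectation (\<lambda>\<omega>. exp (- (l * Lhat B n \<omega>))) \<le> exp (- ((T - \<sigma> / \<kappa> - 0) / 2 * (2 * \<sigma>)))"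
    using discrete_laplace_tendsto[of n l] n l E ev by (intro tendsto_le[OF _ E]) auto
  also have "\<dots> = exp (\<sigma>\<^sup>2 / \<kappa>) * n powr (- \<sigma>)"
    using n by (simp add: powr_def T_def exp_add[symmetric] power2_eq_square field_simps)
  finally show "expectation (\<lambda>\<omega>. exp (- (l * Lhat B n \<omega>))) \<le> exp (\<sigma>\<^sup>2 / \<kappa>) * n powr (- \<sigma>)" .
qed

end

section \<open>The lower tail\<close>

lemma eventually_const_mult_powr_le:
  fixes C x y :: real
  assumes "x < y"
  shows "\<forall>\<^sub>F n :: nat in sequentially. C * real n powr x \<le> real n powr y"
proof -
  have "filterlim (\<lambda>n :: nat. real n powr (y - x)) at_top sequentially"
    using assms by (intro filterlim_compose[OF real_powr_at_top filterlim_real_sequentially]) simp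
  then have "\<forall>\<^sub>F n :: nat in sequentially. C \<le> real n powr (y - x)"
    by (simp add: filterlim_at_top)
  then show ?thesis
  proof eventually_elim
    case (elim n)
    then have "C * real n powr x \<le> real n powr (y - x) * real n powr x"
      by (intro mult_right_mono) auto
    then show ?case by (simp add: powr_add[symmetric])
  qed
qed

text \<open>Here \<open>s + 2 s\<^sup>2\<close> is the Laplace parameter with decay exponent \<open>s\<close>. Its derivative at
  \<open>s\<^sub>0 = (1/c\<^sub>0 - 1)/4\<close> is \<open>1/c\<^sub>0\<close>, so moving away from \<open>s\<^sub>0\<close> gains exponentially on
  either side of the level \<open>c\<^sub>0\<close>.\<close>

lemma tilt_exponent_above:
  fixes c c0 s0 :: real
  assumes c: "0 < c0" "c0 < c" and s0: "s0 = (1 / c0 - 1) / 4" "0 < s0"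
  obtains t \<sigma> where "0 \<le> \<sigma>" "\<sigma> < t" "t < s0" "s0 < \<sigma> + (s0 + 2 * s0\<^sup>2 - (t + 2 * t\<^sup>2)) * c"
proof -
  \<comment> \<open>The second entry makes the quadratic loss at most half of the linear gain
    \<open>\<tau> * (c / c0 - 1)\<close>; the first keeps \<open>s0 - \<tau>\<close>
    positive.\<close>
  define \<tau> where "\<tau> = min (s0 / 2) ((c / c0 - 1) / (4 * c))"
  have half: "y / 2 < y" if "0 < y" for y :: real using that by simp
  have c': "c / c0 - 1 > 0" using c by simp
  have \<tau>: "0 < \<tau>" "\<tau> < s0" using s0 c c' by (auto simp: \<tau>_def)
  have "2 * c * \<tau> \<le> (c / c0 - 1) / 2"
  proof -
    have "2 * c * \<tau> \<le> 2 * c * ((c / c0 - 1) / (4 * c))"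
      using c by (intro mult_left_mono) (auto simp: \<tau>_def)
    also have "\<dots> = (c / c0 - 1) / 2" using c by (simp add: field_simps)
    finally show ?thesis .
  qed
  also have "\<dots> < c / c0 - 1" by (rule half[OF c'])
  finally have \<tau>_less: "\<tau> * (2 * c * \<tau>) < \<tau> * (c / c0 - 1)" using \<tau> by (intro mult_strict_left_mono)
  have diff: "s0 + 2 * s0\<^sup>2 - ((s0 - \<tau>) + 2 * (s0 - \<tau>)\<^sup>2) = \<tau> / c0 - 2 * \<tau>\<^sup>2"
  proof -
    have "s0 + 2 * s0\<^sup>2 - ((s0 - \<tau>) + 2 * (s0 - \<tau>)\<^sup>2) = \<tau> * (1 + 4 * s0) - 2 * \<tau>\<^sup>2"
      by (simp add: power2_eq_square algebra_simps)
    also have "1 + 4 * s0 = 1 / c0" using c by (simp add: s0(1) field_simps)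
    finally show ?thesis by simp
  qed
  have *: "s0 - (s0 + 2 * s0\<^sup>2 - ((s0 - \<tau>) + 2 * (s0 - \<tau>)\<^sup>2)) * c < s0 - \<tau>"
    unfolding diff using \<tau>_less by (simp add: power2_eq_square algebra_simps)
  \<comment> \<open>The inequality just shown leaves a gap below \<open>s0 - \<tau>\<close>, and any
    nonnegative \<sigma> in it works.\<close>
  then obtain \<sigma> where "max 0 (s0 - (s0 + 2 * s0\<^sup>2 - ((s0 - \<tau>) + 2 * (s0 - \<tau>)\<^sup>2)) * c) < \<sigma>" "\<sigma> < s0 - \<tau>"
    using dense[of "max 0 (s0 - (s0 + 2 * s0\<^sup>2 - ((s0 - \<tau>) + 2 * (s0 - \<tau>)\<^sup>2)) * c)" "s0 - \<tau>"] \<tau> by auto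
  then show ?thesis using \<tau> by (intro that[of \<sigma> "s0 - \<tau>"]) auto
qed

lemma tilt_exponent_below:
  fixes c c0 s0 :: real
  assumes c: "0 < c" "c < c0" and s0: "s0 = (1 / c0 - 1) / 4" "0 < s0"
  obtains t \<sigma> where "0 \<le> \<sigma>" "\<sigma> < t" "s0 < t" "s0 < \<sigma> - (t + 2 * t\<^sup>2 - (s0 + 2 * s0\<^sup>2)) * c"
proof -
  \<comment> \<open>Chosen so that the quadratic loss is exactly half of the linear gain
    \<open>\<tau> * (1 - c / c0)\<close>.\<close>
  define \<tau> where "\<tau> = (1 - c / c0) / (4 * c)"
  have half: "y / 2 < y" if "0 < y" for y :: real using that by simp
  have c': "1 - c / c0 > 0" using c by simp
  have \<tau>: "0 < \<tau>" using c c' by (auto simp: \<tau>_def)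
  have "2 * c * \<tau> = (1 - c / c0) / 2" using c by (simp add: \<tau>_def)
  also have "\<dots> < 1 - c / c0" by (rule half[OF c'])
  finally have \<tau>_less: "\<tau> * (2 * c * \<tau>) < \<tau> * (1 - c / c0)" using \<tau> by (intro mult_strict_left_mono)
  have diff: "(s0 + \<tau>) + 2 * (s0 + \<tau>)\<^sup>2 - (s0 + 2 * s0\<^sup>2) = \<tau> / c0 + 2 * \<tau>\<^sup>2"
  proof -
    have "(s0 + \<tau>) + 2 * (s0 + \<tau>)\<^sup>2 - (s0 + 2 * s0\<^sup>2) = \<tau> * (1 + 4 * s0) + 2 * \<tau>\<^sup>2"
      by (simp add: power2_eq_square algebra_simps)
    also have "1 + 4 * s0 = 1 / c0" using c by (simp add: s0(1) field_simps)
    finally show ?thesis by simp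
  qed
  have *: "s0 + ((s0 + \<tau>) + 2 * (s0 + \<tau>)\<^sup>2 - (s0 + 2 * s0\<^sup>2)) * c < s0 + \<tau>"
    unfolding diff using \<tau>_less by (simp add: power2_eq_square algebra_simps)
  then obtain \<sigma> where "max 0 (s0 + ((s0 + \<tau>) + 2 * (s0 + \<tau>)\<^sup>2 - (s0 + 2 * s0\<^sup>2)) * c) < \<sigma>" "\<sigma> < s0 + \<tau>"
    using dense[of "max 0 (s0 + ((s0 + \<tau>) + 2 * (s0 + \<tau>)\<^sup>2 - (s0 + 2 * s0\<^sup>2)) * c)" "s0 + \<tau>"] \<tau> s0(2) by auto
  then show ?thesis using \<tau> by (intro that[of \<sigma> "s0 + \<tau>"]) auto
qed

lemma laplace_parameter_strict_mono:
  fixes s t :: real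
  assumes "0 \<le> s" "s < t"
  shows "s + 2 * s\<^sup>2 < t + 2 * t\<^sup>2"
  using assms power_strict_mono[of s t 2] by simp

text \<open>This \<open>s\<close> is the maximiser of \<open>s - (s + 2 * s\<^sup>2) * c\<close>,
  being the solution of \<open>(1 + 4 * s) * c = 1\<close>. Substituting
  \<open>c * (4 * s) = 1 - c\<close> evaluates the maximum.\<close>

lemma K_eq_legendre:
  assumes "0 < c" "s = (1 / c - 1) / 4"
  shows "K c = s - (s + 2 * s\<^sup>2) * c"
proof -
  have h: "c * (4 * s) = 1 - c" using assms by (simp add: field_simps)
  have "8 * c * (s - (s + 2 * s\<^sup>2) * c) = 2 * (c * (4 * s)) - 2 * c * (c * (4 * s)) - (c * (4 * s))\<^sup>2"
    by (simp add: power2_eq_square algebra_simps)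
  also have "\<dots> = (1 - c)\<^sup>2"
    unfolding h by (simp add: power2_eq_square algebra_simps)
  finally show ?thesis using assms(1) by (simp add: K_def field_simps)
qed

section \<open>Upper tail bound by Chernoff, lower tail bound by tilting\<close>

context brownian_motion
begin

lemma sets_Lhat_le:
  assumes "1 \<le> n"
  shows "{\<omega> \<in> space M. Lhat B n \<omega> \<le> x} \<in> events"
  using measurable_Lhat[OF assms] by measurable

lemma Lhat_le_chernoff:
  assumes n: "1 \<le> n" and l: "0 \<le> l"
  shows "prob {\<omega> \<in> space M. Lhat B n \<omega> \<le> c * ln n}
    \<le> n powr (l * c) * expectation (\<lambda>\<omega>. exp (- (l * Lhat B n \<omega>)))"
proof -
  let ?A = "{\<omega> \<in> space M. Lhat B n \<omega> \<le> c * ln n}"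
  have A: "?A \<in> events" using n by (rule sets_Lhat_le)
  have "prob ?A = expectation (indicator ?A)" using A by simp
  also have "\<dots> \<le> expectation (\<lambda>\<omega>. n powr (l * c) * exp (- (l * Lhat B n \<omega>)))"
  proof (rule integral_mono)
    show "integrable M (indicator ?A :: 'a \<Rightarrow> real)"
      by (rule integrable_real_indicator[OF A]) (simp add: less_top[symmetric])
    show "integrable M (\<lambda>\<omega>. n powr (l * c) * exp (- (l * Lhat B n \<omega>)))"
      using integrable_exp_Lhat[OF n l] by simp
    fix \<omega>
    have "1 \<le> n powr (l * c) * exp (- (l * Lhat B n \<omega>))" if "Lhat B n \<omega> \<le> c * ln n"
      using mult_left_mono[OF that l] n by (simp add: powr_def exp_add[symmetric] mult.assoc)
    then show "indicator ?A \<omega> \<le> n powr (l * c) * exp (- (l * Lhat B n \<omega>))"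
      by (auto simp: indicator_def)
  qed
  finally show ?thesis by simp
qed

text \<open>Chernoff's bound at the optimal parameter \<open>l\<close>. At \<open>c = 1\<close> this
  parameter degenerates to 0, but there \<open>K c = 0\<close> and the trivial bound 1
  suffices.\<close>

lemma prob_Lhat_le_upper:
  assumes c: "0 < c" "c \<le> 1" and \<delta>: "0 < \<delta>"
  shows "\<forall>\<^sub>F n :: nat in sequentially.
    prob {\<omega> \<in> space M. Lhat B (real n) \<omega> \<le> c * ln (real n)} \<le> real n powr (- K c + \<delta>)"
proof (cases "c = 1")
  case True
  have "\<forall>\<^sub>F n :: nat in sequentially. 1 \<le> n" by (rule eventually_ge_at_top)
  then show ?thesis
  proof eventually_elim
    case (elim n)
    have "1 \<le> real n powr \<delta>" using elim \<delta> by (simp add: ge_one_powr_ge_zero)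
    moreover have "prob {\<omega> \<in> space M. Lhat B (real n) \<omega> \<le> c * ln (real n)} \<le> 1" by simp
    ultimately have "prob {\<omega> \<in> space M. Lhat B (real n) \<omega> \<le> c * ln (real n)} \<le> real n powr \<delta>"
      by (rule order.trans[rotated])
    then show ?case using True by (simp add: K_def)
  qed
next
  case False
  define s where "s = (1 / c - 1) / 4"
  have s: "0 < s" using c False by (simp add: s_def)
  define l where "l = s + 2 * s\<^sup>2"
  have l: "0 \<le> l" using s by (simp add: l_def)
  have Kc: "K c = s - l * c" unfolding l_def by (rule K_eq_legendre[OF c(1) s_def])
  \<comment> \<open>Half of \<delta> is given up to get strictly below \<open>s\<close>; the
    remaining half absorbs the constant \<open>C\<close>.\<close>
  define \<sigma> where "\<sigma> = max 0 (s - \<delta> / 2)"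
  have \<sigma>: "0 \<le> \<sigma>" "\<sigma> < s" using s \<delta> by (auto simp: \<sigma>_def)
  obtain C where C: "C > 0" "\<And>n. 1 < n \<Longrightarrow> expectation (\<lambda>\<omega>. exp (- (l * Lhat B n \<omega>))) \<le> C * n powr (- \<sigma>)"
    using laplace_Lhat_upper[OF \<sigma>(1) laplace_parameter_strict_mono[OF \<sigma>]] unfolding l_def by blast
  have "l * c - \<sigma> < - K c + \<delta>" using \<delta> by (simp add: Kc \<sigma>_def)
  from eventually_const_mult_powr_le[OF this, of C] eventually_gt_at_top[of 1]
  show ?thesis
  proof eventually_elim
    case (elim n)
    have "prob {\<omega> \<in> space M. Lhat B (real n) \<omega> \<le> c * ln (real n)}
        \<le> real n powr (l * c) * expectation (\<lambda>\<omega>. exp (- (l * Lhat B (real n) \<omega>)))"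
      using elim l by (intro Lhat_le_chernoff) auto
    also have "\<dots> \<le> real n powr (l * c) * (C * real n powr (- \<sigma>))"
      using elim by (intro mult_left_mono C(2)) auto
    also have "\<dots> = C * real n powr (l * c - \<sigma>)"
      by (simp add: powr_diff powr_minus field_simps)
    also have "\<dots> \<le> real n powr (- K c + \<delta>)" by (rule elim(1))
    finally show ?case .
  qed
qed

text \<open>Splits the tilted expectation over \<open>L < c1 T\<close>, \<open>c1 T \<le> L \<le> c T\<close> and \<open>c T < L\<close> with
  \<open>T = ln n\<close>; the two outer events are bounded by changing the tilt.\<close>

lemma tilted_split:
  assumes n: "1 \<le> n" and l: "0 \<le> l1" "l1 \<le> l0" "l0 \<le> l2"
  shows "expectation (\<lambda>\<omega>. exp (- (l0 * Lhat B n \<omega>)))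
    \<le> n powr (- (l0 * c1)) * prob {\<omega> \<in> space M. Lhat B n \<omega> \<le> c * ln n}
      + n powr (- ((l0 - l1) * c)) * expectation (\<lambda>\<omega>. exp (- (l1 * Lhat B n \<omega>)))
      + n powr ((l2 - l0) * c1) * expectation (\<lambda>\<omega>. exp (- (l2 * Lhat B n \<omega>)))"
proof -
  let ?A = "{\<omega> \<in> space M. Lhat B n \<omega> \<le> c * ln n}"
  have A: "?A \<in> events" using n by (rule sets_Lhat_le)
  have "integrable M (indicator ?A :: 'a \<Rightarrow> real)"
    by (rule integrable_real_indicator[OF A]) (simp add: less_top[symmetric])
  then have int: "integrable M (\<lambda>\<omega>. n powr (- (l0 * c1)) * indicator ?A \<omega>)"
      "integrable M (\<lambda>\<omega>. n powr (- ((l0 - l1) * c)) * exp (- (l1 * Lhat B n \<omega>)))"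
      "integrable M (\<lambda>\<omega>. n powr ((l2 - l0) * c1) * exp (- (l2 * Lhat B n \<omega>)))"
    using integrable_exp_Lhat[OF n, of l1] integrable_exp_Lhat[OF n, of l2] l by auto
  have "expectation (\<lambda>\<omega>. exp (- (l0 * Lhat B n \<omega>)))
    \<le> expectation (\<lambda>\<omega>. n powr (- (l0 * c1)) * indicator ?A \<omega>
      + n powr (- ((l0 - l1) * c)) * exp (- (l1 * Lhat B n \<omega>))
      + n powr ((l2 - l0) * c1) * exp (- (l2 * Lhat B n \<omega>)))"
  proof (rule integral_mono)
    show "integrable M (\<lambda>\<omega>. exp (- (l0 * Lhat B n \<omega>)))"
      using l by (intro integrable_exp_Lhat n) auto
    show "integrable M (\<lambda>\<omega>. n powr (- (l0 * c1)) * indicator ?A \<omega>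
      + n powr (- ((l0 - l1) * c)) * exp (- (l1 * Lhat B n \<omega>))
      + n powr ((l2 - l0) * c1) * exp (- (l2 * Lhat B n \<omega>)))"
      by (intro Bochner_Integration.integrable_add int)
    fix \<omega> assume \<omega>: "\<omega> \<in> space M"
    define x where "x = Lhat B n \<omega>"
    define T where "T = ln n"
    have pw: "n powr y = exp (y * T)" for y
      using n by (auto simp: powr_def T_def)
    \<comment> \<open>In these cases the second, third and first summand, respectively, dominates
      alone; the other two are nonnegative.\<close>
    consider "c * T < x" | "x < c1 * T" | "x \<le> c * T" "c1 * T \<le> x" by linarith
    then show "exp (- (l0 * Lhat B n \<omega>)) \<le> n powr (- (l0 * c1)) * indicator ?A \<omega>
      + n powr (- ((l0 - l1) * c)) * exp (- (l1 * Lhat B n \<omega>))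
      + n powr ((l2 - l0) * c1) * exp (- (l2 * Lhat B n \<omega>))"
      unfolding x_def[symmetric] pw
    proof cases
      case 1
      then have "(l0 - l1) * (c * T) \<le> (l0 - l1) * x" using l by (intro mult_left_mono) auto
      then have "exp (- (l0 * x)) \<le> exp (- ((l0 - l1) * c) * T) * exp (- (l1 * x))"
        by (simp add: exp_add[symmetric] algebra_simps)
      then show "exp (- (l0 * x)) \<le> exp (- (l0 * c1) * T) * indicator ?A \<omega>
        + exp (- ((l0 - l1) * c) * T) * exp (- (l1 * x)) + exp ((l2 - l0) * c1 * T) * exp (- (l2 * x))"
        by (intro add_increasing2 add_increasing) auto
    next
      case 2
      then have "(l2 - l0) * x \<le> (l2 - l0) * (c1 * T)" using l by (intro mult_left_mono) auto
      then have "exp (- (l0 * x)) \<le> exp ((l2 - l0) * c1 * T) * exp (- (l2 * x))"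
        by (simp add: exp_add[symmetric] algebra_simps)
      then show "exp (- (l0 * x)) \<le> exp (- (l0 * c1) * T) * indicator ?A \<omega>
        + exp (- ((l0 - l1) * c) * T) * exp (- (l1 * x)) + exp ((l2 - l0) * c1 * T) * exp (- (l2 * x))"
        by (intro add_increasing) auto
    next
      case 3
      then have "l0 * (c1 * T) \<le> l0 * x" using l by (intro mult_left_mono) auto
      then have "exp (- (l0 * x)) \<le> exp (- (l0 * c1) * T) * indicator ?A \<omega>"
        using 3 \<omega> by (simp add: x_def T_def mult.assoc)
      then show "exp (- (l0 * x)) \<le> exp (- (l0 * c1) * T) * indicator ?A \<omega>
        + exp (- ((l0 - l1) * c) * T) * exp (- (l1 * x)) + exp ((l2 - l0) * c1 * T) * exp (- (l2 * x))"
        by (intro add_increasing2) auto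
    qed
  qed
  also have "\<dots> = n powr (- (l0 * c1)) * prob ?A
      + n powr (- ((l0 - l1) * c)) * expectation (\<lambda>\<omega>. exp (- (l1 * Lhat B n \<omega>)))
      + n powr ((l2 - l0) * c1) * expectation (\<lambda>\<omega>. exp (- (l2 * Lhat B n \<omega>)))"
    using int A by simp
  finally show ?thesis .
qed

text \<open>Under the tilt by \<open>l0\<close> the integral concentrates near
  \<open>c0 * ln n\<close>, strictly between \<open>c1 * ln n\<close> and \<open>c * ln n\<close>.
  The two outer parts are of smaller polynomial order than the total mass
  \<open>n powr (- s0)\<close>, so the middle part carries a third of its lower bound; undoing the
  tilt there gives the factor \<open>n powr (l0 * c1)\<close>.\<close>

lemma prob_Lhat_le_lower_tilted:
  assumes c: "0 < c1" "c1 < c0" "c0 < c" "c \<le> 1" and s0: "s0 = (1 / c0 - 1) / 4"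
    and x: "x < (s0 + 2 * s0\<^sup>2) * c1 - s0"
  shows "\<forall>\<^sub>F n :: nat in sequentially.
    real n powr x \<le> prob {\<omega> \<in> space M. Lhat B (real n) \<omega> \<le> c * ln (real n)}"
proof -
  have c0: "0 < c0" using c by simp
  have s0_pos: "0 < s0" using c by (simp add: s0)
  define l0 where "l0 = s0 + 2 * s0\<^sup>2"
  obtain t1 \<sigma>1 where 1: "0 \<le> \<sigma>1" "\<sigma>1 < t1" "t1 < s0" "s0 < \<sigma>1 + (l0 - (t1 + 2 * t1\<^sup>2)) * c"
    using tilt_exponent_above[OF c0 c(3) s0 s0_pos] unfolding l0_def by blast
  obtain t2 \<sigma>2 where 2: "0 \<le> \<sigma>2" "\<sigma>2 < t2" "s0 < t2" "s0 < \<sigma>2 - ((t2 + 2 * t2\<^sup>2) - l0) * c1"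
    using tilt_exponent_below[OF c(1,2) s0 s0_pos] unfolding l0_def by blast
  define l1 l2 where "l1 = t1 + 2 * t1\<^sup>2" and "l2 = t2 + 2 * t2\<^sup>2"
  have l: "0 \<le> l1" "l1 \<le> l0" "l0 \<le> l2"
    using 1 2 s0_pos laplace_parameter_strict_mono[of t1 s0] laplace_parameter_strict_mono[of s0 t2]
    by (auto simp: l1_def l2_def l0_def)
  obtain C1 where C1: "C1 > 0" "\<And>n. 1 < n \<Longrightarrow> expectation (\<lambda>\<omega>. exp (- (l1 * Lhat B n \<omega>))) \<le> C1 * n powr (- \<sigma>1)"
    using laplace_Lhat_upper[OF 1(1) laplace_parameter_strict_mono[OF 1(1,2)]] unfolding l1_def by blast
  obtain C2 where C2: "C2 > 0" "\<And>n. 1 < n \<Longrightarrow> expectation (\<lambda>\<omega>. exp (- (l2 * Lhat B n \<omega>))) \<le> C2 * n powr (- \<sigma>2)"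
    using laplace_Lhat_upper[OF 2(1) laplace_parameter_strict_mono[OF 2(1,2)]] unfolding l2_def by blast
  define w where "w = sqrt (1 + 2 * s0)"
  have w: "w > 0" using s0_pos by (simp add: w_def)
  \<comment> \<open>The factor \<open>3 * w\<close> ensures that each outer part is at most a third
    of the lower bound \<open>n powr (- s0) / w\<close> for the tilted mass.\<close>
  have ev1: "\<forall>\<^sub>F n :: nat in sequentially. (3 * w * C1) * real n powr (- ((l0 - l1) * c) - \<sigma>1) \<le> real n powr (- s0)"
    using 1 by (intro eventually_const_mult_powr_le) (simp add: l1_def)
  have ev2: "\<forall>\<^sub>F n :: nat in sequentially. (3 * w * C2) * real n powr ((l2 - l0) * c1 - \<sigma>2) \<le> real n powr (- s0)"
    using 2 by (intro eventually_const_mult_powr_le) (simp add: l2_def)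
  have ev3: "\<forall>\<^sub>F n :: nat in sequentially. (3 * w) * real n powr x \<le> real n powr (l0 * c1 - s0)"
    using x by (intro eventually_const_mult_powr_le) (simp add: l0_def)
  from ev1 ev2 ev3 eventually_gt_at_top[of 1] show ?thesis
  proof eventually_elim
    case (elim n)
    define P where "P = prob {\<omega> \<in> space M. Lhat B (real n) \<omega> \<le> c * ln (real n)}"
    define y where "y = real n powr (- s0)"
    have pw: "real n powr a * (C * real n powr (- b)) = C * real n powr (a - b)" for a b C
      using powr_add[of "real n" a "- b"] by simp
    have n: "1 < real n" using elim by simp
    have "y / w \<le> expectation (\<lambda>\<omega>. exp (- (l0 * Lhat B (real n) \<omega>)))"
      unfolding y_def w_def using s0_pos n l by (intro laplace_Lhat_lower) (auto simp: l0_def)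
    also have "\<dots> \<le> real n powr (- (l0 * c1)) * P
      + real n powr (- ((l0 - l1) * c)) * expectation (\<lambda>\<omega>. exp (- (l1 * Lhat B (real n) \<omega>)))
      + real n powr ((l2 - l0) * c1) * expectation (\<lambda>\<omega>. exp (- (l2 * Lhat B (real n) \<omega>)))"
      unfolding P_def using n by (intro tilted_split l) auto
    also have "\<dots> \<le> real n powr (- (l0 * c1)) * P
      + real n powr (- ((l0 - l1) * c)) * (C1 * real n powr (- \<sigma>1))
      + real n powr ((l2 - l0) * c1) * (C2 * real n powr (- \<sigma>2))"
      using C1(2)[OF n] C2(2)[OF n] by (intro add_mono mult_left_mono) auto
    also have "\<dots> = real n powr (- (l0 * c1)) * P
      + C1 * real n powr (- ((l0 - l1) * c) - \<sigma>1) + C2 * real n powr ((l2 - l0) * c1 - \<sigma>2)"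
      by (simp only: pw)
    also have "\<dots> \<le> real n powr (- (l0 * c1)) * P + y / (3 * w) + y / (3 * w)"
    proof -
      have "C1 * real n powr (- ((l0 - l1) * c) - \<sigma>1) \<le> y / (3 * w)"
        using elim(1) w by (simp add: y_def le_divide_eq mult_ac)
      moreover have "C2 * real n powr ((l2 - l0) * c1 - \<sigma>2) \<le> y / (3 * w)"
        using elim(2) w by (simp add: y_def le_divide_eq mult_ac)
      ultimately show ?thesis by linarith
    qed
    finally have "y / (3 * w) \<le> real n powr (- (l0 * c1)) * P"
      by (simp add: field_simps)
    then have "real n powr (l0 * c1) * (y / (3 * w)) \<le> real n powr (l0 * c1) * (real n powr (- (l0 * c1)) * P)"
      by (intro mult_left_mono) auto
    also have "\<dots> = P" using n by (simp add: powr_minus field_simps)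
    also have "real n powr (l0 * c1) * (y / (3 * w)) = real n powr (l0 * c1 - s0) / (3 * w)"
      by (simp add: y_def powr_diff powr_minus field_simps)
    finally have "real n powr (l0 * c1 - s0) \<le> 3 * w * P"
      using w by (simp add: divide_le_eq mult_ac)
    with elim(3) have "3 * w * real n powr x \<le> 3 * w * P" by linarith
    then show ?case using w by (simp add: P_def)
  qed
qed

text \<open>The levels \<open>c * z\<^sup>2 < c * z < c\<close> are used with \<open>z < 1\<close>
  close to 1, where by continuity the exponent approaches \<open>- K c\<close>. The centre
  \<open>c * z\<close> is below 1 even for \<open>c = 1\<close>, so the tilt is always
  positive.\<close>

lemma prob_Lhat_le_lower:
  assumes c: "0 < c" "c \<le> 1" and \<delta>: "0 < \<delta>"
  shows "\<forall>\<^sub>F n :: nat in sequentially.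
    real n powr (- K c - \<delta>) \<le> prob {\<omega> \<in> space M. Lhat B (real n) \<omega> \<le> c * ln (real n)}"
proof -
  define s where "s = (\<lambda>z. (1 / (c * z) - 1) / 4)"
  have "((\<lambda>z. (s z + 2 * (s z)\<^sup>2) * (c * z\<^sup>2) - s z) \<longlongrightarrow> (s 1 + 2 * (s 1)\<^sup>2) * (c * 1\<^sup>2) - s 1) (at_left 1)"
    unfolding s_def using c by (intro tendsto_intros) auto
  moreover have "(s 1 + 2 * (s 1)\<^sup>2) * (c * 1\<^sup>2) - s 1 = - K c"
    using K_eq_legendre[OF c(1), of "s 1"] by (simp add: s_def)
  ultimately have "\<forall>\<^sub>F z in at_left 1. - K c - \<delta> < (s z + 2 * (s z)\<^sup>2) * (c * z\<^sup>2) - s z"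
    using \<delta> by (intro order_tendstoD) auto
  moreover have "\<forall>\<^sub>F z in at_left (1::real). z \<in> {0<..<1}"
    by (rule eventually_at_left_real) simp
  ultimately have "\<forall>\<^sub>F z in at_left 1. z \<in> {0<..<1} \<and> - K c - \<delta> < (s z + 2 * (s z)\<^sup>2) * (c * z\<^sup>2) - s z"
    by eventually_elim auto
  then obtain z where z: "0 < z" "z < 1" "- K c - \<delta> < (s z + 2 * (s z)\<^sup>2) * (c * z\<^sup>2) - s z"
    by (auto dest!: eventually_happens'[OF trivial_limit_at_left_real])
  have "c * z\<^sup>2 < c * z" "c * z < c" using c z by (auto simp: power2_eq_square)
  then show ?thesis
    using c z by (intro prob_Lhat_le_lower_tilted[where ?c0.0 = "c * z" and ?c1.0 = "c * z\<^sup>2" and ?s0.0 = "s z"])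
      (auto simp: s_def)
qed

end

section \<open>From two-sided power bounds to an exponent with vanishing error\<close>

theorem mainTheorem17:
  fixes M :: "'a measure" and B :: "real \<Rightarrow> 'a \<Rightarrow> real" and c :: real
  assumes "standard_brownian_motion M B"
    and "0 < c" and "c \<le> 1"
  shows "\<exists>e :: nat \<Rightarrow> real. e \<longlonglongrightarrow> 0 \<and>
           (\<forall>\<^sub>F n in sequentially.
              measure M {\<omega> \<in> space M. Lhat B (real n) \<omega> \<le> c * ln (real n)}
              = real n powr (- K c + e n))"
proof -
  have "prob_space M" using assms(1) by (simp add: standard_brownian_motion_def)
  then interpret brownian_motion M B
    using assms(1) by (intro brownian_motion.intro) (auto simp: brownian_motion_axioms_def)
  define P where "P = (\<lambda>n. prob {\<omega> \<in> space M. Lhat B (real n) \<omega> \<le> c * ln (real n)})"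
  have lower: "\<forall>\<^sub>F n in sequentially. real n powr (- K c - \<delta>) \<le> P n"
    and upper: "\<forall>\<^sub>F n in sequentially. P n \<le> real n powr (- K c + \<delta>)" if "0 < \<delta>" for \<delta>
    using prob_Lhat_le_lower[OF assms(2,3) that] prob_Lhat_le_upper[OF assms(2,3) that] by (simp_all add: P_def)
  \<comment> \<open>Obtained by solving the claimed identity for the error; this is legitimate once
    \<open>n > 1\<close> and \<open>P n > 0\<close>, and the lower bound with \<delta> = 1 supplies
    the positivity.\<close>
  define e where "e = (\<lambda>n. ln (P n) / ln (real n) + K c)"
  have e: "P n = real n powr (- K c + e n)" if "1 < n" "0 < P n" for n
    using that by (simp add: e_def powr_def)
  have pos: "\<forall>\<^sub>F n in sequentially. 1 < n \<and> 0 < P n"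
    using lower[OF zero_less_one] eventually_gt_at_top[of 1]
  proof eventually_elim
    case (elim n)
    then have "0 < real n powr (- K c - 1)" by simp
    with elim show ?case by linarith
  qed
  have "e \<longlonglongrightarrow> 0"
  proof (rule tendstoI)
    fix \<epsilon> :: real assume \<epsilon>: "\<epsilon> > 0"
    then have h: "\<epsilon> / 2 > 0" by simp
    from lower[OF h] upper[OF h] pos
    show "\<forall>\<^sub>F n in sequentially. dist (e n) 0 < \<epsilon>"
    proof eventually_elim
      case (elim n)
      then have "- K c - \<epsilon> / 2 \<le> - K c + e n" "- K c + e n \<le> - K c + \<epsilon> / 2"
        using e[of n] by (simp_all add: powr_le_cancel_iff)
      then show ?case using \<epsilon> by (simp add: dist_real_def)
    qed
  qed
  moreover have "\<forall>\<^sub>F n in sequentially. P n = real n powr (- K c + e n)"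
    using pos by eventually_elim (rule e, auto)
  ultimately show ?thesis unfolding P_def by blast
qed

end
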